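(* Assume $\mathfrak p=\mathfrak c$. Let $\kappa$ be a cardinal with $\omega\leq\operatorname{cf}(\kappa)=\kappa\leq\mathfrak c$. Then there exists a nonprincipal ultrafilter $\mathcal U$ on $\omega$ such that $\langle\mathcal U,\supseteq^*\rangle\equiv_T\langle[\mathfrak c]^{<\kappa},\subseteq\rangle$.
   Context: A quasiorder is a set with a reflexive transitive relation $\leq$; it is directed if every finite subset has an upper bound in it. For directed sets $P,Q$, a map $f\colon P\to Q$ is Tukey if the $f$-image of every unbounded subset of $P$ is unbounded in $Q$; $P\leq_T Q$ means a Tukey map $P\to Q$ exists; $P\equiv_T Q$ means $P\leq_T Q\leq_T P$. $A\supseteq^* B$ means $B\setminus A$ is finite. $\langle\mathcal U,\supseteq^*\rangle$ denotes $\mathcal U$ quasiordered so that $A\leq B$ iff $A\supseteq^* B$. $\mathfrak c=2^{\aleph_0}$, and $[\mathfrak c]^{<\kappa}$ is the set of subsets of $\mathfrak c$ of size less than $\kappa$. A family $\mathcal A\subseteq\mathcal P(\omega)$ has the strong finite intersection property (SFIP) if $\bigcap\sigma$ is infinite for every finite $\sigma\subseteq\mathcal A$. A nontrivial pseudointersection of $\mathcal A$ is an infinite $b\subseteq\omega$ with $b\setminus a$ finite for all $a\in\mathcal A$. $\mathfrak p$ is the least cardinality of a family of infinite subsets of $\omega$ that has the SFIP but has no nontrivial pseudointersection. *)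

theory Defs
  imports Main
begin

unbundle cardinal_syntax

section \<open>Directed quasiorders and Tukey maps\<close>

text \<open>A quasiorder is a carrier set together with a relation on the ambient type, of which only
  the restriction to the carrier matters.\<close>

definition quasiorder_on :: "'a set \<Rightarrow> ('a \<Rightarrow> 'a \<Rightarrow> bool) \<Rightarrow> bool" where
  "quasiorder_on P le \<longleftrightarrow> reflp_on P le \<and> transp_on P le"

definition bounded_in :: "'a set \<Rightarrow> ('a \<Rightarrow> 'a \<Rightarrow> bool) \<Rightarrow> 'a set \<Rightarrow> bool" where
  "bounded_in P le X \<longleftrightarrow> (\<exists>u\<in>P. \<forall>x\<in>X. le x u)"

definition directed_on :: "'a set \<Rightarrow> ('a \<Rightarrow> 'a \<Rightarrow> bool) \<Rightarrow> bool" where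
  "directed_on P le \<longleftrightarrow>
     quasiorder_on P le \<and> (\<forall>X\<subseteq>P. finite X \<longrightarrow> bounded_in P le X)"

definition tukey_map ::
  "'a set \<Rightarrow> ('a \<Rightarrow> 'a \<Rightarrow> bool) \<Rightarrow> 'b set \<Rightarrow> ('b \<Rightarrow> 'b \<Rightarrow> bool) \<Rightarrow> ('a \<Rightarrow> 'b) \<Rightarrow> bool" where
  "tukey_map P leP Q leQ f \<longleftrightarrow>
     f ` P \<subseteq> Q \<and>
     (\<forall>X\<subseteq>P. \<not> bounded_in P leP X \<longrightarrow> \<not> bounded_in Q leQ (f ` X))"

text \<open>These relations are meant for directed sets only; directedness of the two sets compared in
  the main statement is proved below.\<close>

definition tukey_le ::
  "'a set \<Rightarrow> ('a \<Rightarrow> 'a \<Rightarrow> bool) \<Rightarrow> 'b set \<Rightarrow> ('b \<Rightarrow> 'b \<Rightarrow> bool) \<Rightarrow> bool" where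
  "tukey_le P leP Q leQ \<longleftrightarrow> (\<exists>f. tukey_map P leP Q leQ f)"

definition tukey_equiv ::
  "'a set \<Rightarrow> ('a \<Rightarrow> 'a \<Rightarrow> bool) \<Rightarrow> 'b set \<Rightarrow> ('b \<Rightarrow> 'b \<Rightarrow> bool) \<Rightarrow> bool" where
  "tukey_equiv P leP Q leQ \<longleftrightarrow> tukey_le P leP Q leQ \<and> tukey_le Q leQ P leP"

section \<open>Ultrafilters on the natural numbers\<close>

definition ultrafilter_nat :: "nat set set \<Rightarrow> bool" where
  "ultrafilter_nat U \<longleftrightarrow>
     UNIV \<in> U \<and> {} \<notin> U \<and>
     (\<forall>A\<in>U. \<forall>B\<in>U. A \<inter> B \<in> U) \<and>
     (\<forall>A\<in>U. \<forall>B. A \<subseteq> B \<longrightarrow> B \<in> U) \<and>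
     (\<forall>A. A \<in> U \<or> - A \<in> U)"

definition nonprincipal :: "nat set set \<Rightarrow> bool" where
  "nonprincipal U \<longleftrightarrow> (\<nexists>n. U = {A. n \<in> A})"

definition almost_superset :: "nat set \<Rightarrow> nat set \<Rightarrow> bool"  (infix \<open>\<supseteq>*\<close> 50) where
  "A \<supseteq>* B \<longleftrightarrow> finite (B - A)"

section \<open>The cardinals\<close>

text \<open>As a well-order on its field, \<open>\<cc>\<close> has underlying set the type of all sets of natural
  numbers.\<close>

definition continuum :: "nat set rel"  (\<open>\<cc>\<close>) where
  "\<cc> = |UNIV :: nat set set|"

definition subsets_below :: "'a rel \<Rightarrow> 'k rel \<Rightarrow> 'a set set" where
  "subsets_below r \<kappa> = {X. X \<subseteq> Field r \<and> |X| <o \<kappa>}"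

definition sfip :: "nat set set \<Rightarrow> bool" where
  "sfip \<A> \<longleftrightarrow> (\<forall>\<sigma>\<subseteq>\<A>. finite \<sigma> \<longrightarrow> infinite (\<Inter>\<sigma>))"

definition pseudointersection :: "nat set \<Rightarrow> nat set set \<Rightarrow> bool" where
  "pseudointersection b \<A> \<longleftrightarrow> infinite b \<and> (\<forall>a\<in>\<A>. finite (b - a))"

definition sfip_no_pseudointersection :: "nat set set \<Rightarrow> bool" where
  "sfip_no_pseudointersection \<A> \<longleftrightarrow>
     (\<forall>a\<in>\<A>. infinite a) \<and> sfip \<A> \<and> (\<nexists>b. pseudointersection b \<A>)"

text \<open>The least cardinal is only determined up to order isomorphism of the representing
  well-order, so it is to be compared with \<open>=o\<close>.\<close>

definition pseudointersection_number :: "nat set rel"  (\<open>\<pp>\<close>) where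
  "\<pp> = (SOME r. (\<exists>\<A>. sfip_no_pseudointersection \<A> \<and> r = |\<A>| ) \<and>
                (\<forall>\<B>. sfip_no_pseudointersection \<B> \<longrightarrow> r \<le>o |\<B>| ))"

section \<open>Well-definedness\<close>

lemma continuum_ctwo_cexp: "\<cc> =o ctwo ^c natLeq"
proof -
  have "|Pow (UNIV :: nat set)| =o |Func (UNIV :: nat set) (UNIV :: bool set)|"
    by (rule card_of_Pow_Func)
  also have "|Func (UNIV :: nat set) (UNIV :: bool set)| = ctwo ^c natLeq"
    by (simp add: cexp_def ctwo_def Field_card_of Field_natLeq)
  finally show ?thesis unfolding continuum_def by simp
qed

lemma ex_sfip_no_pseudointersection: "\<exists>\<A>. sfip_no_pseudointersection \<A>"
proof -
  have "\<exists>M\<in>{\<A>. sfip \<A>}. \<forall>X\<in>{\<A>. sfip \<A>}. M \<subseteq> X \<longrightarrow> X = M"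
  proof (rule subset_Zorn)
    fix C assume C: "subset.chain {\<A>. sfip \<A>} C"
    show "\<exists>U\<in>{\<A>. sfip \<A>}. \<forall>X\<in>C. X \<subseteq> U"
    proof (cases "C = {}")
      case True
      have "sfip {}" by (simp add: sfip_def)
      then show ?thesis using True by blast
    next
      case False
      have "sfip (\<Union>C)"
        unfolding sfip_def
      proof (intro allI impI)
        fix \<sigma> assume s: "\<sigma> \<subseteq> \<Union>C" "finite \<sigma>"
        then obtain \<A> where "\<A> \<in> C" "\<sigma> \<subseteq> \<A>"
          using finite_subset_Union_chain[OF s(2,1) False C] by blast
        then show "infinite (\<Inter>\<sigma>)"
          using C s(2) unfolding subset.chain_def sfip_def by blast
      qed
      then show ?thesis by blast
    qed
  qed
  then obtain M where M: "sfip M" and max: "\<And>X. sfip X \<Longrightarrow> M \<subseteq> X \<Longrightarrow> X = M"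
    by blast
  have inf: "infinite a" if "a \<in> M" for a
    using M[unfolded sfip_def, rule_format, of "{a}"] that by simp
  have "\<not> pseudointersection b M" for b
  proof
    assume b: "pseudointersection b M"
    have mem: "c \<in> M" if c: "c \<subseteq> b" "infinite c" for c
    proof -
      have "sfip (insert c M)"
        unfolding sfip_def
      proof (intro allI impI)
        fix \<sigma> assume s: "\<sigma> \<subseteq> insert c M" "finite \<sigma>"
        have "finite (c - a)" if "a \<in> \<sigma>" for a
        proof (cases "a = c")
          case False
          then have "finite (b - a)"
            using that s(1) b unfolding pseudointersection_def by blast
          moreover have "c - a \<subseteq> b - a" using c(1) by blast
          ultimately show ?thesis by (rule finite_subset[rotated])
        qed simp
        then have "finite (\<Union>a\<in>\<sigma>. c - a)" using s(2) by blast
        then have "infinite (c - (\<Union>a\<in>\<sigma>. c - a))" using c(2) by simp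
        moreover have "c - (\<Union>a\<in>\<sigma>. c - a) \<subseteq> \<Inter>\<sigma>" by blast
        ultimately show "infinite (\<Inter>\<sigma>)" using finite_subset by blast
      qed
      then show ?thesis using max by blast
    qed
    have "infinite b" using b by (simp add: pseudointersection_def)
    then obtain f :: "nat \<Rightarrow> nat" where f: "inj f" "range f \<subseteq> b"
      using infinite_countable_subset[of b] by metis
    have inf_img: "infinite (range (\<lambda>n. f (g n)))" if "inj g" for g :: "nat \<Rightarrow> nat"
    proof -
      have "inj (\<lambda>n. f (g n))" using inj_compose[OF f(1) that] by (simp add: comp_def)
      then show ?thesis by (simp add: finite_image_iff)
    qed
    let ?c = "range (\<lambda>n. f (2 * n))" and ?d = "range (\<lambda>n. f (2 * n + 1))"
    have "?c \<subseteq> b" using f(2) by auto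
    moreover have "infinite ?c" by (rule inf_img) (simp add: inj_def)
    ultimately have "?c \<in> M" by (rule mem)
    then have "finite (b - ?c)" using b by (simp add: pseudointersection_def)
    moreover have "?d \<subseteq> b - ?c"
    proof -
      have "f (2 * m + 1) \<noteq> f (2 * n)" for m n
      proof
        assume "f (2 * m + 1) = f (2 * n)"
        then have "2 * m + 1 = 2 * n" using f(1) by (simp add: inj_eq)
        then show False by presburger
      qed
      then show ?thesis using f(2) by auto
    qed
    moreover have "infinite ?d" by (rule inf_img) (simp add: inj_def)
    ultimately show False using finite_subset[of ?d "b - ?c"] by simp
  qed
  then have "sfip_no_pseudointersection M"
    using M inf by (simp add: sfip_no_pseudointersection_def)
  then show ?thesis by blast
qed

lemma pseudointersection_number_least:
  shows "\<exists>\<A>. sfip_no_pseudointersection \<A> \<and> \<pp> = |\<A>|"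
    and "sfip_no_pseudointersection \<B> \<Longrightarrow> \<pp> \<le>o |\<B>|"
proof -
  let ?R = "{r :: nat set rel. \<exists>\<A>. sfip_no_pseudointersection \<A> \<and> r = |\<A>|}"
  have "?R \<noteq> {}" using ex_sfip_no_pseudointersection by blast
  moreover have "\<forall>r\<in>?R. Card_order r" using card_of_Card_order by blast
  ultimately have "\<exists>r\<in>?R. \<forall>r'\<in>?R. r \<le>o r'" by (rule exists_minim_Card_order)
  then have "\<exists>r. (\<exists>\<A>. sfip_no_pseudointersection \<A> \<and> r = |\<A>| ) \<and>
                 (\<forall>\<B>. sfip_no_pseudointersection \<B> \<longrightarrow> r \<le>o |\<B>| )"
    by blast
  from someI_ex[OF this]
  show "\<exists>\<A>. sfip_no_pseudointersection \<A> \<and> \<pp> = |\<A>|"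
    and "sfip_no_pseudointersection \<B> \<Longrightarrow> \<pp> \<le>o |\<B>|"
    unfolding pseudointersection_number_def by blast+
qed

lemma directed_on_ultrafilter:
  assumes "ultrafilter_nat U"
  shows "directed_on U (\<supseteq>*)"
proof -
  have "\<Inter>X \<in> U" if "finite X" "X \<subseteq> U" for X
    using that assms by (induction X) (auto simp: ultrafilter_nat_def)
  moreover have "A \<supseteq>* \<Inter>X" if "A \<in> X" for A X
  proof -
    have "\<Inter>X - A = {}" using that by blast
    then show ?thesis unfolding almost_superset_def by (metis finite.emptyI)
  qed
  moreover have "A \<supseteq>* C" if "A \<supseteq>* B" "B \<supseteq>* C" for A B C
    using that finite_subset[of "C - A" "(C - B) \<union> (B - A)"]
    by (auto simp: almost_superset_def)
  ultimately show ?thesis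
    unfolding directed_on_def quasiorder_on_def bounded_in_def
    by (auto simp: almost_superset_def[of A A for A] intro!: reflp_onI transp_onI)
qed

lemma directed_on_subsets_below:
  fixes r :: "'a rel"
  assumes "Card_order \<kappa>" and "cinfinite \<kappa>"
  shows "directed_on (subsets_below r \<kappa>) (\<subseteq>)"
proof -
  have "|{} :: 'a set| <o \<kappa>"
    using assms by (intro Cfinite_ordLess_Cinfinite)
      (simp_all add: cfinite_def Field_card_of card_of_card_order_on)
  have "\<Union>X \<in> subsets_below r \<kappa>" if "finite X" "X \<subseteq> subsets_below r \<kappa>" for X
    using that
  proof (induction X)
    case empty
    then show ?case using \<open>|{} :: 'a set| <o \<kappa>\<close> by (simp add: subsets_below_def)
  next
    case (insert A X)
    then show ?case
      using card_of_Un_ordLess_infinite_Field[of \<kappa> A "\<Union>X"] assms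
      by (simp add: subsets_below_def cinfinite_def)
  qed
  then have "\<exists>u\<in>subsets_below r \<kappa>. \<forall>x\<in>X. x \<subseteq> u"
    if "finite X" "X \<subseteq> subsets_below r \<kappa>" for X
    using that by (meson Union_upper)
  then show ?thesis
    unfolding directed_on_def quasiorder_on_def bounded_in_def
    by (blast intro: reflp_onI transp_onI)
qed

end

theory Submission
  imports Defs "HOL-Library.Nat_Bijection" "HOL-Library.Infinite_Set"
begin

text \<open>It suffices to find an ultrafilter \<open>U\<close> in which every family of fewer than \<open>\<kappa>\<close> members has a
  pseudointersection, together with \<open>\<cc>\<close> many members \<open>A i\<close> such that each member of \<open>U\<close> is almost
  contained in fewer than \<open>\<kappa>\<close> of them: then \<open>X \<mapsto> {X}\<close> and \<open>S \<mapsto>\<close> (a pseudointersection of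
  \<open>{A i | i \<in> S}\<close>) are Tukey maps. The sets \<open>A i\<close> and the pseudointersections \<open>B i\<close> are chosen together by
  recursion of length \<open>\<cc>\<close>, keeping the generated filter inside the \<^emph>\<open>large\<close> sets: \<open>C\<close> is large if,
  outside a set of fewer than \<open>\<kappa>\<close> indices, no finite union of sets \<open>A i\<close> almost covers it. Since \<open>A i\<close>
  splits everything built before it, largeness is never destroyed later. A task (a family of fewer
  than \<open>\<kappa>\<close> sets) needs to be considered only once: if it cannot be added to the filter when its turn
  comes, it is not contained in the final filter either. The tasks can be listed in length \<open>\<cc>\<close> because
  \<open>2\<^sup>\<lambda> \<le> \<cc>\<close> for all \<open>\<lambda> < \<pp>\<close>.\<close>

section \<open>Cardinal bounds\<close>

lemma finite_ordLess_Cinfinite: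
  assumes "Cinfinite r" "finite A"
  shows "|A| <o r"
  using assms by (intro Cfinite_ordLess_Cinfinite)
    (simp_all add: cfinite_def Field_card_of card_of_card_order_on)

text \<open>Both factors embed in the sum \<open>?D\<close>, which is still smaller than
  \<open>r\<close>, and an infinite set is equinumerous with its square.\<close>

lemma card_of_Times_ordLess:
  assumes r: "Cinfinite r" and A: "|A| <o r" and B: "|B| <o r"
  shows "|A \<times> B| <o r"
proof -
  let ?D = "A <+> B"
  have D: "|?D| <o r"
    using card_of_Plus_ordLess_infinite_Field[of r A B] r A B by (simp add: cinfinite_def)
  show ?thesis
  proof (cases "finite ?D")
    case True
    then have "finite (A \<times> B)" by auto
    then show ?thesis using finite_ordLess_Cinfinite[OF r] by blast
  next
    case False
    have "|A \<times> B| \<le>o |?D \<times> ?D|"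
      by (rule card_of_ordLeqI[of "\<lambda>(a, b). (Inl a, Inr b)"]) (auto simp: inj_on_def)
    also have "|?D \<times> ?D| =o |?D|" using False by (rule card_of_Times_same_infinite)
    finally show ?thesis using D ordLeq_ordLess_trans by blast
  qed
qed

lemma card_of_image_ordLess: "|A| <o r \<Longrightarrow> |f ` A| <o r"
  using card_of_image ordLeq_ordLess_trans by blast

text \<open>Layer by size: a set of size \<open>Suc n\<close> is a point inserted into a set of size
  \<open>n\<close>, so no layer exceeds \<open>A\<close>, and there are countably many
  layers.\<close>

lemma card_of_Fpow_infinite:
  assumes "infinite A"
  shows "|Fpow A| \<le>o |A|"
proof -
  define S where "S n = {X. X \<subseteq> A \<and> finite X \<and> card X = n}" for n
  have "|S n| \<le>o |A|" for n
  proof (induction n)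
    case 0
    have "S 0 = {{}}" by (auto simp: S_def)
    then show ?case using assms card_of_singl_ordLeq[of A "{}"] by fastforce
  next
    case (Suc n)
    have "S (Suc n) \<subseteq> (\<lambda>(a, X). insert a X) ` (A \<times> S n)"
    proof
      fix X assume "X \<in> S (Suc n)"
      then have X: "X \<subseteq> A" "finite X" "card X = Suc n" by (auto simp: S_def)
      then obtain a Y where "X = insert a Y" "a \<notin> Y" "card Y = n" by (metis card_Suc_eq)
      then show "X \<in> (\<lambda>(a, X). insert a X) ` (A \<times> S n)"
        using X by (auto simp: S_def intro!: image_eqI[of _ _ "(a, Y)"])
    qed
    then have "|S (Suc n)| \<le>o |A \<times> S n|" by (rule surj_imp_ordLeq)
    also have "|A \<times> S n| \<le>o |A|"
      using card_of_Sigma_ordLeq_infinite[OF assms, of A "\<lambda>_. S n"] Suc card_of_mono1 by blast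
    finally show ?case .
  qed
  moreover have "|UNIV :: nat set| \<le>o |A|" using assms infinite_iff_card_of_nat by blast
  ultimately have "|\<Union>n. S n| \<le>o |A|"
    using card_of_UNION_ordLeq_infinite[OF assms] by blast
  moreover have "Fpow A = (\<Union>n. S n)" by (auto simp: S_def Fpow_def)
  ultimately show ?thesis by simp
qed

lemma card_of_Fpow_ordLess:
  assumes r: "Cinfinite r" and A: "|A| <o r"
  shows "|Fpow A| <o r"
proof (cases "finite A")
  case True
  then have "finite (Fpow A)" by (simp add: Fpow_def)
  then show ?thesis using finite_ordLess_Cinfinite[OF r] by blast
next
  case False
  then show ?thesis using card_of_Fpow_infinite A ordLeq_ordLess_trans by blast
qed

lemma Card_order_continuum: "Card_order \<cc>"
  by (simp add: continuum_def card_of_Card_order)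

lemma Field_continuum [simp]: "Field \<cc> = UNIV"
  by (simp add: continuum_def Field_card_of)

lemma infinite_UNIV_set_nat: "infinite (UNIV :: nat set set)"
  by (simp add: Finite_Set.finite_set)

lemma Cinfinite_continuum: "Cinfinite \<cc>"
  using Card_order_continuum infinite_UNIV_set_nat by (simp add: cinfinite_def)

lemma nat_ordLess_continuum: "|UNIV :: nat set| <o \<cc>"
  using card_of_Pow[of "UNIV :: nat set"] by (simp add: continuum_def)

section \<open>Families with fewer than \<open>\<cc>\<close> members\<close>

text \<open>The assumption \<open>\<pp> =o \<cc>\<close> enters the construction only in this
  form.\<close>

locale pseudointersections_below_continuum =
  assumes ex_pseudointersection:
    "\<And>\<A>. sfip \<A> \<Longrightarrow> |\<A>| <o \<cc> \<Longrightarrow> \<exists>b. pseudointersection b \<A>"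

lemma pseudointersections_below_continuumI:
  assumes "\<pp> =o \<cc>"
  shows "pseudointersections_below_continuum"
proof
  fix \<A> assume s: "sfip \<A>" and l: "|\<A>| <o \<cc>"
  show "\<exists>b. pseudointersection b \<A>"
  proof (rule ccontr)
    assume n: "\<not> ?thesis"
    have "infinite a" if "a \<in> \<A>" for a
      using s[unfolded sfip_def, rule_format, of "{a}"] that by simp
    then have "sfip_no_pseudointersection \<A>"
      using s n by (simp add: sfip_no_pseudointersection_def)
    then have "\<pp> \<le>o |\<A>|" by (rule pseudointersection_number_least(2))
    then have "\<cc> \<le>o |\<A>|" using assms ordIso_ordLeq_trans ordIso_symmetric by blast
    then show False using l not_ordLess_ordLeq by blast
  qed
qed

text \<open>Choose one point of \<open>E\<close> in each block; disjointness of the blocks makes the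
  choice injective.\<close>

lemma infinite_Int_UN_if_hits_all:
  fixes z :: "nat \<Rightarrow> 'a set"
  assumes "infinite K" and hit: "\<And>k. k \<in> K \<Longrightarrow> E \<inter> z k \<noteq> {}"
    and disj: "\<And>j k. j \<noteq> k \<Longrightarrow> z j \<inter> z k = {}"
  shows "infinite (E \<inter> (\<Union>k\<in>K. z k))"
proof -
  have "\<forall>k\<in>K. \<exists>x. x \<in> E \<inter> z k" using hit by blast
  then obtain e where e: "\<And>k. k \<in> K \<Longrightarrow> e k \<in> E \<inter> z k" by metis
  have "inj_on e K"
  proof (rule inj_onI)
    fix j k assume "j \<in> K" "k \<in> K" "e j = e k"
    then have "e j \<in> z j \<inter> z k" using e by (metis IntD2 IntI)
    then show "j = k" using disj by blast
  qed
  then have "infinite (e ` K)" using assms(1) finite_imageD by blast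
  moreover have "e ` K \<subseteq> E \<inter> (\<Union>k\<in>K. z k)" using e by blast
  ultimately show ?thesis using finite_subset by blast
qed

context pseudointersections_below_continuum
begin

text \<open>Apply the hypothesis to a family of subsets of the countable set of all finite sets of natural
  numbers, coded by natural numbers.\<close>

lemma ex_block_sequence:
  assumes D: "|\<D>| <o \<cc>" and E: "|\<E>| <o \<cc>"
    and sfip: "\<And>e \<F>. e \<in> insert UNIV \<E> \<Longrightarrow> \<F> \<subseteq> \<D> \<Longrightarrow> finite \<F> \<Longrightarrow> infinite (e \<inter> \<Inter>\<F>)"
  obtains z :: "nat \<Rightarrow> nat set" where
    "\<And>k. finite (z k)" "\<And>j k. j \<noteq> k \<Longrightarrow> z j \<inter> z k = {}"
    "\<And>d. d \<in> \<D> \<Longrightarrow> finite {k. \<not> z k \<subseteq> d}"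
    "\<And>e. e \<in> \<E> \<Longrightarrow> finite {k. e \<inter> z k = {}}"
proof -
  \<comment> \<open>Requirements on a block, given by its code. Taking \<open>UNIV\<close> for
    \<open>d\<close> switches that demand off; for \<open>e\<close> it only demands a nonempty
    block. A pseudointersection of \<open>\<A>\<close> is thus a supply of blocks obeying each
    requirement with finitely many exceptions.\<close>
  define h :: "nat set \<times> nat set \<times> nat \<Rightarrow> nat set" where
    "h = (\<lambda>(d, e, m). {n. set_decode n \<subseteq> d \<inter> {m..} \<and> e \<inter> set_decode n \<noteq> {}})"
  define \<A> where "\<A> = h ` (insert UNIV \<D> \<times> insert UNIV \<E> \<times> UNIV)"
  have ins: "|insert UNIV \<X>| <o \<cc>" if "|\<X>| <o \<cc>" for \<X> :: "nat set set"
    using card_of_Un_ordLess_infinite_Field[OF _ Card_order_continuum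
        finite_ordLess_Cinfinite[OF Cinfinite_continuum, of "{UNIV}"] that]
    by (simp add: infinite_UNIV_set_nat)
  have "|\<A>| <o \<cc>"
    unfolding \<A>_def by (intro card_of_image_ordLess card_of_Times_ordLess
        Cinfinite_continuum ins D E nat_ordLess_continuum)
  moreover have "sfip \<A>"
    unfolding sfip_def
  proof (intro allI impI)
    fix \<sigma> assume "\<sigma> \<subseteq> \<A>" "finite \<sigma>"
    then obtain \<tau> where \<tau>: "\<tau> \<subseteq> insert UNIV \<D> \<times> insert UNIV \<E> \<times> UNIV" "finite \<tau>" "\<sigma> = h ` \<tau>"
      unfolding \<A>_def by (metis finite_subset_image)
    \<comment> \<open>\<open>UNIV\<close> need not belong to \<open>\<D>\<close> and is dropped,
      which leaves the intersection unchanged; it is put into \<open>\<G>\<close> to make the block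
      built below nonempty.\<close>
    define \<F> where "\<F> = fst ` \<tau> - {UNIV}"
    define \<G> where "\<G> = insert UNIV ((fst \<circ> snd) ` \<tau>)"
    have F: "\<F> \<subseteq> \<D>" "finite \<F>" and G: "\<G> \<subseteq> insert UNIV \<E>" "finite \<G>"
      using \<tau> by (auto simp: \<F>_def \<G>_def)
    obtain M where M: "\<And>d e m. (d, e, m) \<in> \<tau> \<Longrightarrow> m \<le> M"
    proof
      fix d e m assume "(d, e, m) \<in> \<tau>"
      then have "m \<in> (snd \<circ> snd) ` \<tau>" by force
      then show "m \<le> Max ((snd \<circ> snd) ` \<tau>)" using \<tau>(2) by simp
    qed
    \<comment> \<open>The block takes one point for each \<open>e\<close> in \<open>\<G>\<close>,
      inside all sets of \<open>\<F>\<close> and beyond \<open>M\<close> and \<open>N\<close>. As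
      \<open>N\<close> is arbitrary, the blocks escape every bound, so there are infinitely many
      codes.\<close>
    have "\<exists>n \<in> \<Inter>\<sigma>. set_decode n \<noteq> {} \<and> set_decode n \<subseteq> {N..}" for N
    proof -
      have "\<exists>x \<in> e \<inter> \<Inter>\<F>. max M N \<le> x" if "e \<in> \<G>" for e
        using sfip[of e \<F>] that F G by (meson infinite_nat_iff_unbounded_le subsetD)
      then obtain x where x: "\<And>e. e \<in> \<G> \<Longrightarrow> x e \<in> e \<inter> \<Inter>\<F> \<and> max M N \<le> x e"
        by metis
      let ?n = "set_encode (x ` \<G>)"
      have dec: "set_decode ?n = x ` \<G>" using G(2) by simp
      have "?n \<in> h (d, e, m)" if t: "(d, e, m) \<in> \<tau>" for d e m
      proof -
        have "d \<in> insert UNIV \<F>" using t by (force simp: \<F>_def)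
        moreover have "e \<inter> x ` \<G> \<noteq> {}"
        proof -
          have "e \<in> \<G>" using t by (force simp: \<G>_def)
          then show ?thesis using x by blast
        qed
        ultimately show ?thesis
          unfolding h_def prod.case mem_Collect_eq dec
          using x le_trans[OF M[OF t]] by auto
      qed
      then have "?n \<in> \<Inter>\<sigma>" unfolding \<tau>(3) by auto
      moreover have "\<G> \<noteq> {}" by (simp add: \<G>_def)
      ultimately show ?thesis using dec x by (intro bexI[of _ ?n]) auto
    qed
    note ex = this
    show "infinite (\<Inter>\<sigma>)"
    proof
      assume "finite (\<Inter>\<sigma>)"
      then have "finite (\<Union>n \<in> \<Inter>\<sigma>. set_decode n)" by (rule finite_UN_I) simp
      then obtain N where "(\<Union>n \<in> \<Inter>\<sigma>. set_decode n) \<subseteq> {..<N}"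
        using finite_nat_iff_bounded by blast
      moreover obtain n x where "n \<in> \<Inter>\<sigma>" "x \<in> set_decode n" "set_decode n \<subseteq> {N..}"
        using ex[of N] by blast
      ultimately have "x < N" "N \<le> x" by auto
      then show False by simp
    qed
  qed
  ultimately have "\<exists>Z. pseudointersection Z \<A>" by (intro ex_pseudointersection)
  then obtain Z where Z: "infinite Z" "\<And>a. a \<in> \<A> \<Longrightarrow> finite (Z - a)"
    unfolding pseudointersection_def by blast
  have W: "\<exists>n\<in>Z. l < n \<and> set_decode n \<noteq> {} \<and> set_decode n \<subseteq> {m..}" for l m
  proof -
    have "h (UNIV, UNIV, m) \<in> \<A>" by (simp add: \<A>_def)
    then have "infinite (Z - (Z - h (UNIV, UNIV, m)))" using Z by (metis Diff_infinite_finite)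
    then obtain n where "n \<in> Z - (Z - h (UNIV, UNIV, m))" "l < n"
      using infinite_nat_iff_unbounded by blast
    then show ?thesis by (auto simp: h_def)
  qed
  \<comment> \<open>Blocks are picked from left to right to be disjoint; nonemptiness lets the order
    pass through intermediate blocks, and increasing codes make \<open>f\<close> injective.\<close>
  have "\<exists>f. \<forall>k. (f k \<in> Z \<and> set_decode (f k) \<noteq> {}) \<and>
      (f k < f (Suc k) \<and> (\<forall>x\<in>set_decode (f k). \<forall>y\<in>set_decode (f (Suc k)). x < y))"
  proof (rule dependent_nat_choice)
    show "\<exists>n. n \<in> Z \<and> set_decode n \<noteq> {}" using W by blast
    fix n :: nat
    obtain N where N: "set_decode n \<subseteq> {..<N}"
      using finite_nat_iff_bounded finite_set_decode by blast
    obtain n' where n': "n' \<in> Z" "n < n'" "set_decode n' \<noteq> {}" "set_decode n' \<subseteq> {N..}"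
      using W by blast
    then have "\<forall>x\<in>set_decode n. \<forall>y\<in>set_decode n'. x < y" using N by fastforce
    then show "\<exists>n'. (n' \<in> Z \<and> set_decode n' \<noteq> {}) \<and>
        n < n' \<and> (\<forall>x\<in>set_decode n. \<forall>y\<in>set_decode n'. x < y)"
      using n' by blast
  qed
  then obtain f where f: "\<And>k. f k \<in> Z" "\<And>k. set_decode (f k) \<noteq> {}"
      "\<And>k. f k < f (Suc k)"
      "\<And>k x y. x \<in> set_decode (f k) \<Longrightarrow> y \<in> set_decode (f (Suc k)) \<Longrightarrow> x < y"
    by blast
  have less: "x < y" if "j < k" "x \<in> set_decode (f j)" "y \<in> set_decode (f k)" for j k x y
    using that
  proof (induction k arbitrary: y)
    case (Suc k)
    show ?case
    proof (cases "j = k")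
      case True
      then show ?thesis using f(4) Suc.prems by blast
    next
      case False
      obtain w where w: "w \<in> set_decode (f k)" using f(2) by blast
      have "x < w" using Suc.IH[OF _ Suc.prems(2) w] False Suc.prems(1) by simp
      also have "w < y" using f(4) w Suc.prems(3) by blast
      finally show ?thesis .
    qed
  qed simp
  have "inj f" using f(3) by (simp add: strict_mono_Suc_iff strict_mono_imp_inj_on)
  then have fin: "finite {k. f k \<notin> a}" if "a \<in> \<A>" for a
  proof -
    have "f ` {k. f k \<notin> a} \<subseteq> Z - a" using f(1) by blast
    then have "finite (f ` {k. f k \<notin> a})" using Z(2)[OF that] by (rule finite_subset)
    then show ?thesis using \<open>inj f\<close> by (meson finite_imageD inj_on_subset subset_UNIV)
  qed
  show thesis
  proof
    show "finite (set_decode (f k))" for k by simp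
    show "set_decode (f j) \<inter> set_decode (f k) = {}" if "j \<noteq> k" for j k
      using that less by (metis disjoint_iff linorder_neqE_nat nat_neq_iff)
    show "finite {k. \<not> set_decode (f k) \<subseteq> d}" if "d \<in> \<D>" for d
    proof -
      have "h (d, UNIV, 0) \<in> \<A>" using that by (simp add: \<A>_def)
      from fin[OF this] show ?thesis by (rule finite_subset[rotated]) (auto simp: h_def)
    qed
    show "finite {k. e \<inter> set_decode (f k) = {}}" if "e \<in> \<E>" for e
    proof -
      have "h (UNIV, e, 0) \<in> \<A>" using that by (simp add: \<A>_def)
      from fin[OF this] show ?thesis by (rule finite_subset[rotated]) (auto simp: h_def)
    qed
  qed
qed

text \<open>Take the union of all blocks: each \<open>d\<close> fails to contain only finitely many
  of them, all finite, while each \<open>e\<close> hits almost all of the disjoint blocks. It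
  provides the sets \<open>B i\<close>.\<close>

lemma ex_pseudointersection_meeting:
  assumes "|\<D> :: nat set set| <o \<cc>" and "|\<E>| <o \<cc>"
    and "\<And>e \<F>. e \<in> insert UNIV \<E> \<Longrightarrow> \<F> \<subseteq> \<D> \<Longrightarrow> finite \<F> \<Longrightarrow> infinite (e \<inter> \<Inter>\<F>)"
  shows "\<exists>b. (\<forall>d\<in>\<D>. finite (b - d)) \<and> (\<forall>e\<in>\<E>. infinite (e \<inter> b))"
proof -
  obtain z :: "nat \<Rightarrow> nat set" where z: "\<And>k. finite (z k)"
    "\<And>j k. j \<noteq> k \<Longrightarrow> z j \<inter> z k = {}" "\<And>d. d \<in> \<D> \<Longrightarrow> finite {k. \<not> z k \<subseteq> d}"
    "\<And>e. e \<in> \<E> \<Longrightarrow> finite {k. e \<inter> z k = {}}"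
    using ex_block_sequence[OF assms] by blast
  have "finite ((\<Union>k. z k) - d)" if "d \<in> \<D>" for d
  proof (rule finite_subset)
    show "(\<Union>k. z k) - d \<subseteq> (\<Union>k\<in>{k. \<not> z k \<subseteq> d}. z k)" by blast
    show "finite (\<Union>k\<in>{k. \<not> z k \<subseteq> d}. z k)" using z(1,3) that by blast
  qed
  moreover have "infinite (e \<inter> (\<Union>k. z k))" if "e \<in> \<E>" for e
  proof -
    let ?K = "- {k. e \<inter> z k = {}}"
    have "infinite ?K" using z(4)[OF that] by (simp add: finite_compl)
    then have "infinite (e \<inter> (\<Union>k\<in>?K. z k))"
      using z(2) by (intro infinite_Int_UN_if_hits_all) auto
    then show ?thesis by (rule infinite_super[rotated]) blast
  qed
  ultimately show ?thesis by blast
qed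

text \<open>Apply the block sequence with \<open>\<D>\<close> empty. Each \<open>e\<close> hits
  almost every block, so the union of the even-numbered blocks splits all \<open>e\<close> at
  once.\<close>

lemma ex_splitting:
  assumes "|\<E> :: nat set set| <o \<cc>" and inf: "\<And>e. e \<in> \<E> \<Longrightarrow> infinite e"
  shows "\<exists>a. \<forall>e\<in>\<E>. infinite (e \<inter> a) \<and> infinite (e - a)"
proof -
  have D: "|{} :: nat set set| <o \<cc>"
    by (rule finite_ordLess_Cinfinite[OF Cinfinite_continuum finite.emptyI])
  have E: "infinite (e \<inter> \<Inter>\<F>)"
    if "e \<in> insert UNIV \<E>" "\<F> \<subseteq> {}" "finite \<F>" for e and \<F> :: "nat set set"
  proof -
    have "infinite e" using that(1) inf infinite_UNIV_nat by (cases "e = UNIV") simp_all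
    moreover have "\<F> = {}" using that(2) by simp
    ultimately show ?thesis by simp
  qed
  obtain z :: "nat \<Rightarrow> nat set" where z:
    "\<And>j k. j \<noteq> k \<Longrightarrow> z j \<inter> z k = {}" "\<And>e. e \<in> \<E> \<Longrightarrow> finite {k. e \<inter> z k = {}}"
    by (rule ex_block_sequence[OF D assms(1) E]) blast+
  let ?a = "\<Union>k\<in>{k. even k}. z k"
  have par: "infinite (e \<inter> (\<Union>k\<in>P. z k))" if "e \<in> \<E>" "infinite P" for e P
  proof -
    let ?K = "P - {k. e \<inter> z k = {}}"
    have "infinite ?K" using z(2)[OF that(1)] that(2) by simp
    then have "infinite (e \<inter> (\<Union>k\<in>?K. z k))"
      using z(1) by (intro infinite_Int_UN_if_hits_all) auto
    then show ?thesis by (rule infinite_super[rotated]) blast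
  qed
  have ev: "infinite {k::nat. even k}"
    unfolding infinite_nat_iff_unbounded_le
  proof
    fix m :: nat
    show "\<exists>n\<ge>m. n \<in> {k. even k}" by (rule exI[of _ "2 * m"]) simp
  qed
  have od: "infinite {k::nat. odd k}"
    unfolding infinite_nat_iff_unbounded_le
  proof
    fix m :: nat
    show "\<exists>n\<ge>m. n \<in> {k. odd k}" by (rule exI[of _ "2 * m + 1"]) simp
  qed
  have sub: "e \<inter> (\<Union>k\<in>{k. odd k}. z k) \<subseteq> e - ?a" for e
  proof
    fix x assume "x \<in> e \<inter> (\<Union>k\<in>{k. odd k}. z k)"
    then obtain k where k: "x \<in> e" "odd k" "x \<in> z k" by blast
    have "x \<notin> z j" if "even j" for j
      using z(1)[of j k] that k by (metis disjoint_iff)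
    then show "x \<in> e - ?a" using k by blast
  qed
  have "infinite (e \<inter> ?a) \<and> infinite (e - ?a)" if "e \<in> \<E>" for e
    using infinite_super[OF sub par[OF that od]] par[OF that ev] by (rule conjI[rotated])
  then show ?thesis by (intro exI[of _ ?a] ballI)
qed

text \<open>The sets \<open>T s x\<close> below form a binary tree of height \<open>|S|\<close> that decreases along branches, and
  different branches have almost disjoint pseudointersections.\<close>

lemma card_of_Pow_ordLeq_continuum:
  assumes S: "|S :: 'a set| <o \<cc>"
  shows "|Pow S| \<le>o \<cc>"
proof -
  define R where "R = |S| - Id"
  have wo: "Well_order |S|" by (rule card_of_Well_order)
  then have wf: "wf R" by (simp add: R_def well_order_on_def)
  have lin: "(x, y) \<in> R \<or> (y, x) \<in> R \<or> x = y" if "x \<in> S" "y \<in> S" for x y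
    using wo that by (auto simp: R_def well_order_on_def linear_order_on_def total_on_def Field_card_of)
  have RS: "x \<in> S" "y \<in> S" if "(x, y) \<in> R" for x y
    using that by (metis DiffD1 Field_card_of FieldI1 FieldI2 R_def)+
  have trR: "(x, w) \<in> R" if "(x, y) \<in> R" "(y, w) \<in> R" for x y w
    using that wo unfolding R_def
    by (auto simp: well_order_on_def linear_order_on_def partial_order_on_def preorder_on_def
        antisym_def dest: transD)
  define half :: "nat set \<Rightarrow> nat set" where
    "half b = (SOME h. infinite (b \<inter> h) \<and> infinite (b - h))" for b
  have half: "infinite (b \<inter> half b) \<and> infinite (b - half b)" if "infinite b" for b
  proof -
    have "|{b}| <o \<cc>" by (intro finite_ordLess_Cinfinite[OF Cinfinite_continuum]) simp
    then have "\<exists>h. infinite (b \<inter> h) \<and> infinite (b - h)"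
      using ex_splitting[of "{b}"] that by simp
    then show ?thesis unfolding half_def by (rule someI_ex)
  qed
  \<comment> \<open>Membership of \<open>x\<close> in \<open>s\<close> will be the bit
    \<open>p\<close>, so that subsets disagreeing at \<open>x\<close> take opposite halves.\<close>
  define side where "side p b = (if p then b \<inter> half b else b - half b)" for p b
  have side: "side p b \<subseteq> b" "infinite b \<Longrightarrow> infinite (side p b)"
    "side p b \<inter> side (\<not> p) b = {}" for p b
    using half by (auto simp: side_def)
  define pi where "pi \<A> = (SOME b. pseudointersection b \<A>)" for \<A>
  have pi: "pseudointersection (pi \<A>) \<A>" if "sfip \<A>" "|\<A>| <o \<cc>" for \<A>
    unfolding pi_def using ex_pseudointersection[OF that] by (rule someI_ex)
  \<comment> \<open>A pseudointersection of all earlier values carries the branch through limits; it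
    is then halved.\<close>
  define T where "T s = wfrec R (\<lambda>f x. side (x \<in> s) (pi (f ` {y. (y, x) \<in> R})))" for s :: "'a set"
  have T: "T s x = side (x \<in> s) (pi (T s ` {y. (y, x) \<in> R}))" for s x
  proof -
    have "cut (T s) R x ` {y. (y, x) \<in> R} = T s ` {y. (y, x) \<in> R}"
      by (rule image_cong) (auto simp: cut_apply)
    then show ?thesis unfolding T_def by (subst wfrec[OF wf]) simp
  qed
  have chain: "sfip (T s ` X)" if X: "X \<subseteq> S"
    and inf: "\<And>x. x \<in> X \<Longrightarrow> infinite (T s x)"
    and dec: "\<And>x y. x \<in> X \<Longrightarrow> y \<in> X \<Longrightarrow> (y, x) \<in> R \<Longrightarrow> finite (T s x - T s y)" for s X
    unfolding sfip_def
  proof (intro allI impI)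
    fix \<sigma> assume "\<sigma> \<subseteq> T s ` X" "finite \<sigma>"
    then obtain \<tau> where \<tau>: "\<tau> \<subseteq> X" "finite \<tau>" "\<sigma> = T s ` \<tau>"
      by (metis finite_subset_image)
    show "infinite (\<Inter>\<sigma>)"
    proof (cases "\<tau> = {}")
      case False
      \<comment> \<open>The \<open>R\<close>-last index carries a set almost contained in all the
        others.\<close>
      have "\<exists>m\<in>\<tau>. \<forall>y\<in>\<tau>. y = m \<or> (y, m) \<in> R"
        using \<tau>(2) False \<tau>(1)
      proof (induction rule: finite_ne_induct)
        case (insert x F)
        then obtain m where m: "m \<in> F" "\<forall>y\<in>F. y = m \<or> (y, m) \<in> R" by auto
        have "x \<in> S" "m \<in> S" using insert.prems X m(1) by auto
        then consider "(x, m) \<in> R" | "(m, x) \<in> R" | "x = m" using lin by blast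
        then show ?case
        proof cases
          case 2
          then have "\<forall>y\<in>insert x F. y = x \<or> (y, x) \<in> R" using m(2) trR[OF _ 2] 2 by fastforce
            then show ?thesis by blast
        qed (use m in blast)+
      qed simp
      then obtain m where m: "m \<in> \<tau>" "\<And>y. y \<in> \<tau> \<Longrightarrow> y = m \<or> (y, m) \<in> R" by blast
      have "finite (T s m - T s y)" if "y \<in> \<tau>" for y
        using m(2)[OF that] dec[of m y] m(1) \<tau>(1) that by auto
      then have "finite (\<Union>y\<in>\<tau>. T s m - T s y)" using \<tau>(2) by blast
      then have "infinite (T s m - (\<Union>y\<in>\<tau>. T s m - T s y))" using inf m(1) \<tau>(1) by auto
      moreover have "T s m - (\<Union>y\<in>\<tau>. T s m - T s y) \<subseteq> \<Inter>\<sigma>" using \<tau>(3) by blast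
      ultimately show ?thesis using finite_subset by blast
    qed (simp add: \<tau>(3))
  qed
  have small: "|T s ` X| <o \<cc>" if "X \<subseteq> S" for s X
    using card_of_image_ordLess ordLeq_ordLess_trans[OF card_of_mono1[OF that] S] by blast
  have Tx: "infinite (T s x) \<and> (\<forall>y. (y, x) \<in> R \<longrightarrow> finite (T s x - T s y))" for s x
    using wf
  proof (induction x)
    case (less x)
    let ?X = "{y. (y, x) \<in> R}"
    let ?p = "pi (T s ` ?X)"
    have X: "?X \<subseteq> S" using RS(1) by blast
    have "sfip (T s ` ?X)" by (rule chain[OF X]) (use less in simp_all)
    then have p: "infinite ?p" "\<And>y. (y, x) \<in> R \<Longrightarrow> finite (?p - T s y)"
      using pi[OF _ small[OF X]] unfolding pseudointersection_def by simp_all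
    have "finite (T s x - T s y)" if "(y, x) \<in> R" for y
      using p(2)[OF that] by (rule finite_subset[rotated]) (use side(1) T[of s x] in blast)
    moreover have "infinite (T s x)" using side(2)[OF p(1)] T[of s x] by simp
    ultimately show ?case by simp
  qed
  have top: "pseudointersection (pi (T s ` S)) (T s ` S)" for s
    by (rule pi[OF chain[OF subset_refl] small[OF subset_refl]]) (use Tx in simp_all)
  \<comment> \<open>At the least \<open>x\<close> where \<open>s\<close> and \<open>t\<close>
    differ, the earlier values agree, so \<open>T s x\<close> and \<open>T t x\<close> are disjoint
    halves of one set; no infinite set is almost contained in both.\<close>
  have "inj_on (\<lambda>s. pi (T s ` S)) (Pow S)"
  proof (rule inj_onI, rule ccontr)
    fix s t assume st: "s \<in> Pow S" "t \<in> Pow S" "pi (T s ` S) = pi (T t ` S)" "s \<noteq> t"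
    then obtain x0 where "x0 \<in> {x. (x \<in> s) \<noteq> (x \<in> t)}" by blast
    then obtain x where x: "(x \<in> s) \<noteq> (x \<in> t)" and min: "\<And>y. (y, x) \<in> R \<Longrightarrow> (y \<in> s) = (y \<in> t)"
      by (rule wfE_min[OF wf]) simp
    have "(y, x) \<in> R \<longrightarrow> T s y = T t y" for y
      using wf
    proof (induction y)
      case (less y)
      show ?case
      proof
        assume y: "(y, x) \<in> R"
        then have "T s ` {z. (z, y) \<in> R} = T t ` {z. (z, y) \<in> R}"
          using less trR[OF _ y] by (intro image_cong) simp_all
        then show "T s y = T t y" unfolding T[of s y] T[of t y] using min[OF y] by simp
      qed
    qed
    then have "T s ` {z. (z, x) \<in> R} = T t ` {z. (z, x) \<in> R}" by (intro image_cong) simp_all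
    then have disj: "T s x \<inter> T t x = {}"
      unfolding T[of s x] T[of t x] using side(3)[of "x \<in> s"] x by simp
    have "x \<in> S" using x st by auto
    then have "finite (pi (T s ` S) - T s x)" "finite (pi (T s ` S) - T t x)" "infinite (pi (T s ` S))"
      using top[of s] top[of t] st(3) unfolding pseudointersection_def by auto
    moreover have "pi (T s ` S) \<subseteq> (pi (T s ` S) - T s x) \<union> (pi (T s ` S) - T t x)"
      using disj by blast
    ultimately show False using finite_subset by blast
  qed
  then show ?thesis unfolding continuum_def by (rule card_of_ordLeqI) simp
qed

text \<open>A family smaller than \<open>\<cc>\<close> is indexed by a proper initial segment, hence
  coded by that segment and a subset of its product with the naturals. By the bound on power sets
  each segment has at most \<open>\<cc>\<close> codes, and there are at most \<open>\<cc>\<close>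
  segments.\<close>

lemma ex_enumeration_small_families:
  "\<exists>t :: nat set \<Rightarrow> nat set set. \<forall>s. |s| <o \<cc> \<longrightarrow> s \<in> range t"
proof -
  define \<Q> where "\<Q> = (SIGMA j : (UNIV :: nat set set). Pow (underS \<cc> j \<times> (UNIV :: nat set)))"
  define g :: "nat set \<times> (nat set \<times> nat) set \<Rightarrow> nat set set" where
    "g = (\<lambda>(j, w). (\<lambda>x. {n. (x, n) \<in> w}) ` underS \<cc> j)"
  have und: "|underS \<cc> j| <o \<cc>" for j
    using card_of_underS[OF Card_order_continuum] by simp
  have "|Pow (underS \<cc> j \<times> (UNIV :: nat set))| \<le>o \<cc>" for j
    by (intro card_of_Pow_ordLeq_continuum card_of_Times_ordLess Cinfinite_continuum und
        nat_ordLess_continuum)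
  then have "|\<Q>| \<le>o \<cc>"
    unfolding \<Q>_def
    by (intro card_of_Sigma_ordLeq_infinite_Field Card_order_continuum)
       (simp_all add: infinite_UNIV_set_nat, simp add: continuum_def card_of_refl ordIso_imp_ordLeq)
  moreover have "\<Q> \<noteq> {}" by (auto simp: \<Q>_def)
  ultimately obtain e where e: "e ` (UNIV :: nat set set) = \<Q>"
    using card_of_ordLeq2[of \<Q> "UNIV :: nat set set"] unfolding continuum_def by blast
  have "s \<in> range (g \<circ> e)" if s: "|s| <o \<cc>" for s
  proof -
    obtain j where j: "|s| =o Restr \<cc> (underS \<cc> j)"
      using iffD1[OF ordLess_iff_ordIso_Restr s] Card_order_continuum card_of_Well_order[of s]
      unfolding card_order_on_def by blast
    have "Field (Restr \<cc> (underS \<cc> j)) = underS \<cc> j"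
    proof (rule Field_Restr_ofilter)
      show wo: "Well_order \<cc>" using Card_order_continuum by (simp add: card_order_on_def)
      then show "ofilter \<cc> (underS \<cc> j)" by (simp add: wo_rel.underS_ofilter wo_rel_def)
    qed
    then have "|s| =o |underS \<cc> j|"
      using card_of_cong[OF j] by (simp add: Field_card_of)
    then obtain f where "bij_betw f (underS \<cc> j) s"
      using card_of_ordIso[of "underS \<cc> j" s] ordIso_symmetric[of "|s|"] by blast
    then have "f ` underS \<cc> j = s" by (simp add: bij_betw_def)
    then have "s = g (j, {(x, n). x \<in> underS \<cc> j \<and> n \<in> f x})"
      by (simp add: g_def)
    moreover have "(j, {(x, n). x \<in> underS \<cc> j \<and> n \<in> f x}) \<in> \<Q>" by (auto simp: \<Q>_def)
    ultimately have "s \<in> g ` range e" using e by blast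
    then show ?thesis by (simp only: image_comp)
  qed
  then show ?thesis by blast
qed

end

section \<open>The construction\<close>

definition meets :: "nat set set \<Rightarrow> nat set set" where
  "meets \<G> = Inter ` Fpow \<G>"

lemma meets_Un: "X \<in> meets (\<G> \<union> \<H>) \<longleftrightarrow> (\<exists>C\<in>meets \<G>. \<exists>D\<in>meets \<H>. X = C \<inter> D)"
proof
  assume "X \<in> meets (\<G> \<union> \<H>)"
  then obtain F where F: "F \<subseteq> \<G> \<union> \<H>" "finite F" "X = \<Inter>F" by (auto simp: meets_def Fpow_def)
  have "\<Inter>(F \<inter> \<G>) \<in> meets \<G>" "\<Inter>(F - \<G>) \<in> meets \<H>"
    using F(1,2) by (auto simp: meets_def Fpow_def)
  moreover have "X = \<Inter>(F \<inter> \<G>) \<inter> \<Inter>(F - \<G>)" using F(3) by blast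
  ultimately show "\<exists>C\<in>meets \<G>. \<exists>D\<in>meets \<H>. X = C \<inter> D" by blast
next
  assume "\<exists>C\<in>meets \<G>. \<exists>D\<in>meets \<H>. X = C \<inter> D"
  then obtain F H where "F \<subseteq> \<G>" "finite F" "H \<subseteq> \<H>" "finite H" "X = \<Inter>F \<inter> \<Inter>H"
    by (auto simp: meets_def Fpow_def)
  then have "F \<union> H \<in> Fpow (\<G> \<union> \<H>)" "X = \<Inter>(F \<union> H)" by (auto simp: Fpow_def)
  then show "X \<in> meets (\<G> \<union> \<H>)" by (simp add: meets_def)
qed

lemma UNIV_in_meets: "UNIV \<in> meets \<G>"
  by (auto simp: meets_def Fpow_def intro!: image_eqI[of _ _ "{}"])

lemma meets_base: "x \<in> \<G> \<Longrightarrow> x \<in> meets \<G>"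
  by (auto simp: meets_def Fpow_def intro!: image_eqI[of _ _ "{x}"])

lemma meets_mono: "\<G> \<subseteq> \<H> \<Longrightarrow> meets \<G> \<subseteq> meets \<H>"
  unfolding meets_def by (intro image_mono Fpow_mono)

lemma meets_Int: "C \<in> meets \<G> \<Longrightarrow> D \<in> meets \<G> \<Longrightarrow> C \<inter> D \<in> meets \<G>"
  using meets_Un[of "C \<inter> D" \<G> \<G>] by auto

lemma meets_singleton: "D \<in> meets {b} \<Longrightarrow> b \<subseteq> D"
  by (auto simp: meets_def Fpow_def)

lemma meets_insert: "X \<in> meets (insert b \<G>) \<Longrightarrow> \<exists>C\<in>meets \<G>. C \<inter> b \<subseteq> X"
  unfolding insert_is_Un[of b \<G>] meets_Un using meets_singleton[of _ b] by blast

text \<open>Used at stages whose task is refused, where \<open>B i\<close> has the default value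
  \<open>UNIV\<close>.\<close>

lemma meets_insert_UNIV: "meets (insert UNIV \<G>) = meets \<G>"
proof
  show "meets (insert UNIV \<G>) \<subseteq> meets \<G>"
  proof
    fix X assume "X \<in> meets (insert UNIV \<G>)"
    then obtain D C where "D \<in> meets {UNIV}" "C \<in> meets \<G>" "X = D \<inter> C"
      unfolding insert_is_Un[of UNIV \<G>] meets_Un by blast
    then show "X \<in> meets \<G>" using meets_singleton[of D UNIV] by (simp add: top.extremum_unique)
  qed
qed (simp add: meets_mono subset_insertI)

lemma card_of_meets_ordLess: "Cinfinite r \<Longrightarrow> |\<G>| <o r \<Longrightarrow> |meets \<G>| <o r"
  unfolding meets_def by (intro card_of_image_ordLess card_of_Fpow_ordLess)

text \<open>The sets that are not large form an ideal, since one exceptional set \<open>T\<close> can serve both halves of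
  a partition; so adding \<open>X\<close> or its complement keeps a filter of large sets large.\<close>

definition large :: "'k rel \<Rightarrow> ('i \<Rightarrow> nat set) \<Rightarrow> 'i set \<Rightarrow> nat set \<Rightarrow> bool" where
  "large \<kappa> A J C \<longleftrightarrow>
     (\<exists>T. |T| <o \<kappa> \<and> (\<forall>\<sigma>\<in>Fpow J. \<sigma> \<inter> T = {} \<longrightarrow> infinite (C - \<Union>(A ` \<sigma>))))"

lemma large_almost_superset:
  assumes "large \<kappa> A J C" "finite (C - C')"
  shows "large \<kappa> A J C'"
proof -
  have "infinite (C' - X)" if "infinite (C - X)" for X
  proof
    assume "finite (C' - X)"
    then have "finite ((C' - X) \<union> (C - C'))" using assms(2) by simp
    moreover have "C - X \<subseteq> (C' - X) \<union> (C - C')" by blast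
    ultimately show False using that finite_subset by blast
  qed
  then show ?thesis using assms(1) unfolding large_def by meson
qed

lemma large_superset: "large \<kappa> A J C \<Longrightarrow> C \<subseteq> C' \<Longrightarrow> large \<kappa> A J C'"
  using large_almost_superset[of \<kappa> A J C C'] by (metis Diff_eq_empty_iff finite.emptyI)

lemma large_antimono: "large \<kappa> A J C \<Longrightarrow> K \<subseteq> J \<Longrightarrow> large \<kappa> A K C"
  unfolding large_def by (meson Fpow_mono subsetD)

lemma large_infinite: "large \<kappa> A J C \<Longrightarrow> infinite C"
  unfolding large_def by (auto dest: bspec[OF _ empty_in_Fpow])

text \<open>The source of the ultrafilter property: almost covers of the two pieces would join into
  one of \<open>C\<close>.\<close>

lemma large_Int_or_Diff:
  assumes "large \<kappa> A J C"
  shows "large \<kappa> A J (C \<inter> X) \<or> large \<kappa> A J (C - X)"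
proof (rule ccontr)
  assume n: "\<not> ?thesis"
  obtain T where T: "|T| <o \<kappa>" "\<And>\<sigma>. \<sigma> \<in> Fpow J \<Longrightarrow> \<sigma> \<inter> T = {} \<Longrightarrow> infinite (C - \<Union>(A ` \<sigma>))"
    using assms unfolding large_def by blast
  obtain \<sigma> where \<sigma>: "\<sigma> \<in> Fpow J" "\<sigma> \<inter> T = {}" "finite (C \<inter> X - \<Union>(A ` \<sigma>))"
    using n T(1) unfolding large_def by blast
  obtain \<tau> where \<tau>: "\<tau> \<in> Fpow J" "\<tau> \<inter> T = {}" "finite (C - X - \<Union>(A ` \<tau>))"
    using n T(1) unfolding large_def by blast
  have "infinite (C - \<Union>(A ` (\<sigma> \<union> \<tau>)))" using T(2)[of "\<sigma> \<union> \<tau>"] \<sigma>(1,2) \<tau>(1,2) by (auto simp: Fpow_def)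
  moreover have "C - \<Union>(A ` (\<sigma> \<union> \<tau>)) \<subseteq> (C \<inter> X - \<Union>(A ` \<sigma>)) \<union> (C - X - \<Union>(A ` \<tau>))" by blast
  ultimately show False using \<sigma>(3) \<tau>(3) finite_subset by blast
qed

lemma large_cong: "(\<And>j. j \<in> J \<Longrightarrow> A j = A' j) \<Longrightarrow> large \<kappa> A J C = large \<kappa> A' J C"
proof -
  assume "\<And>j. j \<in> J \<Longrightarrow> A j = A' j"
  then have "\<And>\<sigma>. \<sigma> \<in> Fpow J \<Longrightarrow> A ` \<sigma> = A' ` \<sigma>" by (intro image_cong) (auto simp: Fpow_def)
  then show ?thesis unfolding large_def by simp
qed

text \<open>Singletons \<open>\<sigma>\<close> suffice: an \<open>i\<close> with \<open>C\<close>
  almost inside \<open>A i\<close> must be exceptional. This supplies the upper bound for the second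
  Tukey map.\<close>

lemma card_of_large: "large \<kappa> A UNIV C \<Longrightarrow> |{i. finite (C - A i)}| <o \<kappa>"
proof -
  assume "large \<kappa> A UNIV C"
  then obtain T where T: "|T| <o \<kappa>"
    "\<And>\<sigma>. finite \<sigma> \<Longrightarrow> \<sigma> \<inter> T = {} \<Longrightarrow> infinite (C - \<Union>(A ` \<sigma>))"
    unfolding large_def Fpow_def by auto
  have "i \<in> T" if "finite (C - A i)" for i
    using T(2)[of "{i}"] that by auto
  then have "|{i. finite (C - A i)}| \<le>o |T|" by (intro card_of_mono1) blast
  then show ?thesis using T(1) ordLeq_ordLess_trans by blast
qed

section \<open>Stages: sets of naturals as indices under the well-order of the continuum\<close>

abbreviation (input) before :: "nat set \<Rightarrow> nat set set" where
  "before i \<equiv> underS \<cc> i"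

abbreviation (input) up_to :: "nat set \<Rightarrow> nat set set" where
  "up_to i \<equiv> insert i (underS \<cc> i)"

lemma wf_continuum: "wf (\<cc> - Id)"
  using Card_order_continuum by (simp add: card_order_on_def well_order_on_def)

lemma before_iff: "(j, i) \<in> \<cc> - Id \<longleftrightarrow> j \<in> before i"
  by (auto simp: underS_def)

lemma linear_continuum: "Linear_order \<cc>"
  using Card_order_continuum by (simp add: card_order_on_def well_order_on_def)

lemma before_total: "j \<in> before i \<or> i \<in> before j \<or> i = j"
  using linear_continuum by (auto simp: linear_order_on_def total_on_def underS_def)

lemma before_trans: "k \<in> before j \<Longrightarrow> j \<in> before i \<Longrightarrow> k \<in> before i"
  using linear_continuum
  by (auto simp: linear_order_on_def partial_order_on_def preorder_on_def underS_def
      dest: transD antisymD)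

lemma before_irrefl: "i \<notin> before i"
  by (simp add: underS_def)

lemma card_of_before: "|before i| <o \<cc>"
  using card_of_underS[OF Card_order_continuum] by simp

lemma ex_last:
  assumes "finite \<sigma>" "\<sigma> \<noteq> {}"
  obtains m where "m \<in> \<sigma>" "\<sigma> \<subseteq> up_to m"
proof -
  have "\<exists>m\<in>\<sigma>. \<sigma> \<subseteq> up_to m"
    using assms
  proof (induction rule: finite_ne_induct)
    case (insert x F)
    then obtain m where m: "m \<in> F" "F \<subseteq> up_to m" by blast
    consider "x \<in> up_to m" | "m \<in> before x" using before_total by blast
    then show ?case
    proof cases
      case 1
      then show ?thesis using m by blast
    next
      case 2
      then have "F \<subseteq> up_to x" using m(2) before_trans[OF _ 2] by blast
      then show ?thesis by blast
    qed
  qed simp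
  then show thesis using that by blast
qed

text \<open>The generators are \<open>A i\<close> and \<open>B i\<close>. Each \<open>A i\<close> is generic over the generators that precede it,
  and \<open>B i\<close> is a pseudointersection of the task \<open>t i\<close> whenever largeness does not rule this out.\<close>

definition gens :: "('i \<Rightarrow> nat set) \<Rightarrow> ('i \<Rightarrow> nat set) \<Rightarrow> 'i set \<Rightarrow> nat set set" where
  "gens A B K = A ` K \<union> B ` K"

lemma card_of_gens_before: "|gens A B (before i)| <o \<cc>"
  unfolding gens_def
  by (intro card_of_Un_ordLess_infinite_Field card_of_image_ordLess card_of_before
      Card_order_continuum) (simp add: infinite_UNIV_set_nat)

text \<open>Both halves matter: the part inside \<open>a\<close> keeps sets large when
  \<open>A i\<close> joins the filter, the part outside when \<open>A i\<close> joins the covering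
  sets.\<close>

definition splits :: "(nat set \<Rightarrow> nat set) \<Rightarrow> (nat set \<Rightarrow> nat set) \<Rightarrow> nat set \<Rightarrow> nat set \<Rightarrow> bool" where
  "splits A B i a \<longleftrightarrow> (\<forall>C\<in>meets (gens A B (before i)). \<forall>\<sigma>\<in>Fpow (before i).
     infinite (C - \<Union>(A ` \<sigma>)) \<longrightarrow>
     infinite ((C - \<Union>(A ` \<sigma>)) \<inter> a) \<and> infinite ((C - \<Union>(A ` \<sigma>)) - a))"

text \<open>Largeness is tested only against indices up to \<open>i\<close>, so the test can be made
  during the recursion.\<close>

definition admissible ::
  "'k rel \<Rightarrow> (nat set \<Rightarrow> nat set) \<Rightarrow> nat set \<Rightarrow> nat set set \<Rightarrow> nat set set \<Rightarrow> bool" where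
  "admissible \<kappa> A i \<G> s \<longleftrightarrow> |s| <o \<kappa> \<and> (\<forall>C\<in>meets (\<G> \<union> s). large \<kappa> A (up_to i) C)"

text \<open>The default \<open>UNIV\<close> adds nothing to the filter.\<close>

definition meets_task ::
  "'k rel \<Rightarrow> (nat set \<Rightarrow> nat set) \<Rightarrow> nat set \<Rightarrow> nat set set \<Rightarrow> nat set set \<Rightarrow> nat set \<Rightarrow> bool" where
  "meets_task \<kappa> A i \<G> s b \<longleftrightarrow>
     (if admissible \<kappa> A i \<G> s
      then (\<forall>x\<in>s. finite (b - x)) \<and> (\<forall>C\<in>meets (insert b \<G>). large \<kappa> A (up_to i) C)
      else b = UNIV)"

definition stage ::
  "'k rel \<Rightarrow> (nat set \<Rightarrow> nat set set) \<Rightarrow> (nat set \<Rightarrow> nat set) \<Rightarrow> (nat set \<Rightarrow> nat set) \<Rightarrow> nat set \<Rightarrow> bool"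
where
  "stage \<kappa> t A B i \<longleftrightarrow> splits A B i (A i) \<and>
     meets_task \<kappa> A i (insert (A i) (gens A B (before i))) (t i) (B i)"

text \<open>Locality of the requirement, which makes well-founded recursion applicable.\<close>

lemma stage_cong:
  assumes "\<And>j. j \<in> up_to i \<Longrightarrow> A j = A' j" "\<And>j. j \<in> up_to i \<Longrightarrow> B j = B' j"
  shows "stage \<kappa> t A B i = stage \<kappa> t A' B' i"
proof -
  have "A ` before i = A' ` before i" "B ` before i = B' ` before i"
    using assms by (intro image_cong; simp)+
  then have g: "gens A B (before i) = gens A' B' (before i)" by (simp add: gens_def)
  have "A ` \<sigma> = A' ` \<sigma>" if "\<sigma> \<in> Fpow (before i)" for \<sigma>
    using assms(1) that by (intro image_cong) (auto simp: Fpow_def)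
  moreover have "large \<kappa> A (up_to i) = large \<kappa> A' (up_to i)"
    using assms(1) by (intro ext large_cong)
  ultimately show ?thesis
    unfolding stage_def splits_def meets_task_def admissible_def g using assms by simp
qed

section \<open>Existence of suitable sets at every stage\<close>

locale tukey_construction = pseudointersections_below_continuum +
  fixes \<kappa> :: "'k rel"
  assumes Cinfinite: "Cinfinite \<kappa>" and regular: "regularCard \<kappa>" and ordLeq_continuum: "\<kappa> \<le>o \<cc>"
begin

text \<open>Fewer than \<open>\<cc>\<close> generators precede \<open>i\<close>, so fewer than
  \<open>\<cc>\<close> sets have to be split.\<close>

lemma ex_splits: "\<exists>a. splits A B i a"
proof -
  define \<E> where "\<E> = {e \<in> (\<lambda>(C, \<sigma>). C - \<Union>(A ` \<sigma>)) `
    (meets (gens A B (before i)) \<times> Fpow (before i)). infinite e}"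
  have "|(\<lambda>(C, \<sigma>). C - \<Union>(A ` \<sigma>)) ` (meets (gens A B (before i)) \<times> Fpow (before i))| <o \<cc>"
    by (intro card_of_image_ordLess card_of_Times_ordLess card_of_meets_ordLess card_of_Fpow_ordLess
        Cinfinite_continuum card_of_before card_of_gens_before)
  then have "|\<E>| <o \<cc>"
    by (rule ordLeq_ordLess_trans[OF card_of_mono1, rotated]) (auto simp: \<E>_def)
  then have "\<exists>a. \<forall>e\<in>\<E>. infinite (e \<inter> a) \<and> infinite (e - a)"
    by (rule ex_splitting) (simp add: \<E>_def)
  then obtain a where a: "\<And>e. e \<in> \<E> \<Longrightarrow> infinite (e \<inter> a) \<and> infinite (e - a)" by blast
  have "splits A B i a"
    unfolding splits_def
  proof (intro ballI impI)
    fix C \<sigma> assume "C \<in> meets (gens A B (before i))" "\<sigma> \<in> Fpow (before i)" "infinite (C - \<Union>(A ` \<sigma>))"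
    then have "C - \<Union>(A ` \<sigma>) \<in> \<E>"
      unfolding \<E>_def by (auto intro!: image_eqI[of _ _ "(C, \<sigma>)"])
    then show "infinite ((C - \<Union>(A ` \<sigma>)) \<inter> a) \<and> infinite ((C - \<Union>(A ` \<sigma>)) - a)" by (rule a)
  qed
  then show ?thesis by blast
qed

text \<open>For an admissible task, take a pseudointersection of \<open>s\<close> meeting in an
  infinite set every \<open>C\<close> minus a finite union of sets \<open>A j\<close> with
  unexceptional \<open>j\<close>.\<close>

lemma ex_meets_task:
  assumes G: "|\<G>| <o \<cc>"
  shows "\<exists>b. meets_task \<kappa> A i \<G> s b"
proof (cases "admissible \<kappa> A i \<G> s")
  case True
  then have s: "|s| <o \<kappa>" and lg: "\<And>C D. C \<in> meets \<G> \<Longrightarrow> D \<in> meets s \<Longrightarrow> large \<kappa> A (up_to i) (C \<inter> D)"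
    unfolding admissible_def using meets_Un[of _ \<G> s] by blast+
  have "\<forall>C\<in>meets \<G>. \<forall>D\<in>meets s. \<exists>T. |T| <o \<kappa> \<and>
      (\<forall>\<sigma>\<in>Fpow (up_to i). \<sigma> \<inter> T = {} \<longrightarrow> infinite (C \<inter> D - \<Union>(A ` \<sigma>)))"
    using lg unfolding large_def by blast
  then obtain T where T: "\<And>C D. C \<in> meets \<G> \<Longrightarrow> D \<in> meets s \<Longrightarrow> |T C D| <o \<kappa>"
    "\<And>C D \<sigma>. C \<in> meets \<G> \<Longrightarrow> D \<in> meets s \<Longrightarrow> \<sigma> \<in> Fpow (up_to i) \<Longrightarrow> \<sigma> \<inter> T C D = {} \<Longrightarrow>
      infinite (C \<inter> D - \<Union>(A ` \<sigma>))"
    by metis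
  \<comment> \<open>One exceptional set for \<open>C\<close> against all finite intersections from
    \<open>s\<close> simultaneously; regularity of \<open>\<kappa>\<close> keeps it small.\<close>
  define T' where "T' C = (\<Union>D\<in>meets s. T C D)" for C
  have T': "|T' C| <o \<kappa>" if "C \<in> meets \<G>" for C
    unfolding T'_def using T(1)[OF that]
    by (intro card_of_UNION_ordLess_infinite_Field_regularCard regular Cinfinite
        card_of_meets_ordLess s ballI)
  \<comment> \<open>Keeping all these remainders infinite inside \<open>b\<close> makes
    \<open>T' C\<close> an exceptional set for \<open>C \<inter> b\<close>.\<close>
  define \<E> where "\<E> = (\<lambda>(C, \<sigma>). C - \<Union>(A ` \<sigma>)) `
    {(C, \<sigma>) \<in> meets \<G> \<times> Fpow (up_to i). \<sigma> \<inter> T' C = {}}"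
  have up_to: "|up_to i| <o \<cc>"
    using card_of_Un_ordLess_infinite_Field[OF _ Card_order_continuum
        finite_ordLess_Cinfinite[OF Cinfinite_continuum, of "{i}"] card_of_before]
    by (simp add: infinite_UNIV_set_nat)
  have "|\<E>| \<le>o |meets \<G> \<times> Fpow (up_to i)|"
    unfolding \<E>_def by (rule ordLeq_transitive[OF card_of_image card_of_mono1]) blast
  also have "|meets \<G> \<times> Fpow (up_to i)| <o \<cc>"
    by (intro card_of_Times_ordLess card_of_meets_ordLess card_of_Fpow_ordLess
        Cinfinite_continuum up_to G)
  finally have E: "|\<E>| <o \<cc>" .
  have "\<exists>b. (\<forall>d\<in>s. finite (b - d)) \<and> (\<forall>e\<in>\<E>. infinite (e \<inter> b))"
  proof (rule ex_pseudointersection_meeting[OF _ E])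
    show "|s| <o \<cc>" using s ordLeq_continuum by (rule ordLess_ordLeq_trans)
    fix e \<F> assume e: "e \<in> insert UNIV \<E>" and F: "\<F> \<subseteq> s" "finite \<F>"
    have D: "\<Inter>\<F> \<in> meets s" using F by (simp add: meets_def Fpow_def)
    \<comment> \<open>The extra test set \<open>UNIV\<close> is the remainder with
      \<open>C = UNIV\<close> and empty \<open>\<sigma>\<close>.\<close>
    have "UNIV \<in> \<E>" unfolding \<E>_def
      using UNIV_in_meets empty_in_Fpow by (force intro!: image_eqI[of _ _ "(UNIV, {})"])
    then have "e \<in> \<E>" using e by blast
    then obtain C \<sigma> where C: "C \<in> meets \<G>" "\<sigma> \<in> Fpow (up_to i)" "\<sigma> \<inter> T' C = {}" "e = C - \<Union>(A ` \<sigma>)"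
      unfolding \<E>_def by blast
    have "\<sigma> \<inter> T C (\<Inter>\<F>) = {}" using C(3) D by (auto simp: T'_def)
    from T(2)[OF C(1) D C(2) this] have "infinite (C \<inter> \<Inter>\<F> - \<Union>(A ` \<sigma>))" .
    moreover have "C \<inter> \<Inter>\<F> - \<Union>(A ` \<sigma>) = e \<inter> \<Inter>\<F>" using C(4) by blast
    ultimately show "infinite (e \<inter> \<Inter>\<F>)" by simp
  qed
  then obtain b where b: "\<And>x. x \<in> s \<Longrightarrow> finite (b - x)" "\<And>e. e \<in> \<E> \<Longrightarrow> infinite (e \<inter> b)" by blast
  have "large \<kappa> A (up_to i) X" if "X \<in> meets (insert b \<G>)" for X
  proof -
    obtain C where C: "C \<in> meets \<G>" "C \<inter> b \<subseteq> X" using meets_insert[OF \<open>X \<in> meets (insert b \<G>)\<close>] by blast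
    have "infinite (C \<inter> b - \<Union>(A ` \<sigma>))" if "\<sigma> \<in> Fpow (up_to i)" "\<sigma> \<inter> T' C = {}" for \<sigma>
    proof -
      have "C - \<Union>(A ` \<sigma>) \<in> \<E>" unfolding \<E>_def using that C(1) by force
      from b(2)[OF this] show ?thesis by (metis Int_Diff Int_commute)
    qed
    then have "large \<kappa> A (up_to i) (C \<inter> b)" unfolding large_def using T'[OF C(1)] by blast
    then show ?thesis using C(2) by (rule large_superset)
  qed
  then show ?thesis using True b(1) unfolding meets_task_def by auto
qed (simp add: meets_task_def)

lemma ex_stages: "\<exists>A B. \<forall>i. stage \<kappa> t A B i"
proof -
  \<comment> \<open>\<open>f i\<close> is the pair of \<open>A i\<close> and \<open>B i\<close>. The
    trivial update separates the value at \<open>i\<close> from the earlier ones, as recursion with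
    choice requires.\<close>
  have "\<exists>f. \<forall>i. stage \<kappa> t (\<lambda>j. fst ((f(i := f i)) j)) (\<lambda>j. snd ((f(i := f i)) j)) i"
  proof (rule dependent_wf_choice[OF wf_continuum, where
        P = "\<lambda>f i r. stage \<kappa> t (\<lambda>j. fst ((f(i := r)) j)) (\<lambda>j. snd ((f(i := r)) j)) i"])
    fix f g :: "nat set \<Rightarrow> nat set \<times> nat set" and i r
    assume "\<And>z. (z, i) \<in> \<cc> - Id \<Longrightarrow> f z = g z"
    then show "stage \<kappa> t (\<lambda>j. fst ((f(i := r)) j)) (\<lambda>j. snd ((f(i := r)) j)) i =
        stage \<kappa> t (\<lambda>j. fst ((g(i := r)) j)) (\<lambda>j. snd ((g(i := r)) j)) i"
      unfolding before_iff by (intro stage_cong) auto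
  next
    fix i and f :: "nat set \<Rightarrow> nat set \<times> nat set"
    define A B where "A = fst \<circ> f" and "B = snd \<circ> f"
    obtain a where a: "splits A B i a" using ex_splits by blast
    have "|insert a (gens A B (before i))| <o \<cc>"
      using card_of_Un_ordLess_infinite_Field[OF _ Card_order_continuum
          finite_ordLess_Cinfinite[OF Cinfinite_continuum, of "{a}"] card_of_gens_before]
      by (simp add: infinite_UNIV_set_nat)
    \<comment> \<open>The set \<open>a\<close> is fixed first, since largeness up to
      \<open>i\<close> already refers to the value of \<open>A\<close> at \<open>i\<close>.\<close>
    then obtain b where b: "meets_task \<kappa> (A(i := a)) i (insert a (gens A B (before i))) (t i) b"
      using ex_meets_task by blast
    let ?A = "A(i := a)" and ?B = "B(i := b)"
    have im: "?A ` \<sigma> = A ` \<sigma>" "?B ` \<sigma> = B ` \<sigma>" if "\<sigma> \<subseteq> before i" for \<sigma>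
      using that before_irrefl by (auto intro!: image_cong)
    have g: "gens ?A ?B (before i) = gens A B (before i)"
      unfolding gens_def im[OF subset_refl] by (rule refl)
    have "splits ?A ?B i a"
      unfolding splits_def g
    proof (intro ballI)
      fix C \<sigma> assume C: "C \<in> meets (gens A B (before i))" and s: "\<sigma> \<in> Fpow (before i)"
      have eq: "?A ` \<sigma> = A ` \<sigma>" using s by (intro im) (simp add: Fpow_def)
      show "infinite (C - \<Union>(?A ` \<sigma>)) \<longrightarrow>
          infinite ((C - \<Union>(?A ` \<sigma>)) \<inter> a) \<and> infinite ((C - \<Union>(?A ` \<sigma>)) - a)"
        unfolding eq using a C s unfolding splits_def by blast
    qed
    then have "stage \<kappa> t ?A ?B i" using b unfolding stage_def g by simp
    moreover have "?A = (\<lambda>j. fst ((f(i := (a, b))) j))" "?B = (\<lambda>j. snd ((f(i := (a, b))) j))"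
      by (auto simp: A_def B_def fun_eq_iff)
    ultimately have "stage \<kappa> t (\<lambda>j. fst ((f(i := (a, b))) j)) (\<lambda>j. snd ((f(i := (a, b))) j)) i"
      by (simp only:)
    then show "\<exists>r. stage \<kappa> t (\<lambda>j. fst ((f(i := r)) j)) (\<lambda>j. snd ((f(i := r)) j)) i" ..
  qed
  then show ?thesis by (simp only: fun_upd_triv) blast
qed

end

section \<open>Preservation of largeness along the recursion\<close>

locale tukey_stages = tukey_construction +
  fixes t :: "nat set \<Rightarrow> nat set set" and A B :: "nat set \<Rightarrow> nat set"
  assumes stage: "stage \<kappa> t A B i" and enumerates: "|s| <o \<cc> \<Longrightarrow> s \<in> range t"
begin

text \<open>Remove the last index \<open>m\<close> of \<open>\<sigma>\<close>. If \<open>m\<close>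
  is outside the initial segment \<open>K\<close>, then \<open>C\<close> is built before
  \<open>m\<close>, and \<open>A m\<close> splits what remains of \<open>C\<close>, so it cannot
  almost cover it.\<close>

lemma infinite_Diff_extend:
  assumes K: "\<And>k. k \<in> K \<Longrightarrow> before k \<subseteq> K" and C: "C \<in> meets (gens A B K)"
    and "finite \<sigma>" "infinite (C - \<Union>(A ` (\<sigma> \<inter> K)))"
  shows "infinite (C - \<Union>(A ` \<sigma>))"
  using assms(3,4)
proof (induction "card \<sigma>" arbitrary: \<sigma> rule: less_induct)
  case less
  show ?case
  proof (cases "\<sigma> \<subseteq> K")
    case True
    then show ?thesis using less.prems by (simp add: Int_absorb2)
  next
    case False
    then obtain m where m: "m \<in> \<sigma>" "\<sigma> \<subseteq> up_to m" using ex_last[OF less.prems(1)] by blast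
    have mK: "m \<notin> K" using K m False by blast
    have "K \<subseteq> before m" using before_total[of _ m] K mK by blast
    then have Cm: "C \<in> meets (gens A B (before m))"
      using C meets_mono[of "gens A B K" "gens A B (before m)"] unfolding gens_def by blast
    have "card (\<sigma> - {m}) < card \<sigma>" using m(1) less.prems(1) by (meson card_Diff1_less)
    moreover have "(\<sigma> - {m}) \<inter> K = \<sigma> \<inter> K" using mK by blast
    ultimately have "infinite (C - \<Union>(A ` (\<sigma> - {m})))" using less by simp
    moreover have "\<sigma> - {m} \<in> Fpow (before m)" using m less.prems(1) by (auto simp: Fpow_def)
    ultimately have "infinite ((C - \<Union>(A ` (\<sigma> - {m}))) - A m)"
      using stage[of m] Cm unfolding stage_def splits_def by blast
    moreover have "(C - \<Union>(A ` (\<sigma> - {m}))) - A m = C - \<Union>(A ` \<sigma>)" using m(1) by blast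
    ultimately show ?thesis by simp
  qed
qed

text \<open>The exceptional set need not grow: later sets \<open>A j\<close> never complete a cover.
  Hence largeness tested at a stage is final.\<close>

lemma large_extend:
  assumes K: "\<And>k. k \<in> K \<Longrightarrow> before k \<subseteq> K" and C: "C \<in> meets (gens A B K)"
    and "large \<kappa> A K C"
  shows "large \<kappa> A UNIV C"
proof -
  obtain T where T: "|T| <o \<kappa>" "\<And>\<sigma>. \<sigma> \<in> Fpow K \<Longrightarrow> \<sigma> \<inter> T = {} \<Longrightarrow> infinite (C - \<Union>(A ` \<sigma>))"
    using assms(3) unfolding large_def by blast
  have "infinite (C - \<Union>(A ` \<sigma>))" if "\<sigma> \<in> Fpow UNIV" "\<sigma> \<inter> T = {}" for \<sigma>
  proof (rule infinite_Diff_extend[OF K C])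
    show "finite \<sigma>" using that(1) by (simp add: Fpow_def)
    then have "\<sigma> \<inter> K \<in> Fpow K" by (simp add: Fpow_def)
    moreover have "\<sigma> \<inter> K \<inter> T = {}" using that(2) by blast
    ultimately show "infinite (C - \<Union>(A ` (\<sigma> \<inter> K)))" by (rule T(2))
  qed
  then show ?thesis using T(1) unfolding large_def by blast
qed

lemma up_to_downward_closed: "k \<in> up_to i \<Longrightarrow> before k \<subseteq> up_to i"
  using before_trans[of _ k i] by blast

lemma gens_up_to: "gens A B (up_to i) = insert (B i) (insert (A i) (gens A B (before i)))"
  by (auto simp: gens_def)

lemma large_UNIV: "large \<kappa> A UNIV UNIV"
proof (rule large_extend)
  show "UNIV \<in> meets (gens A B {})" by (rule UNIV_in_meets)
  have "|{} :: nat set set| <o \<kappa>" by (rule finite_ordLess_Cinfinite[OF Cinfinite finite.emptyI])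
  then show "large \<kappa> A {} UNIV" unfolding large_def Fpow_def by auto
qed simp

text \<open>A finite intersection uses finitely many generators, all present at the last of their
  stages; this handles limits.\<close>

lemma large_if_large_up_to:
  assumes "\<And>k C. k \<in> K \<Longrightarrow> C \<in> meets (gens A B (up_to k)) \<Longrightarrow> large \<kappa> A UNIV C"
    and C: "C \<in> meets (gens A B K)"
  shows "large \<kappa> A UNIV C"
proof -
  obtain F where F: "F \<subseteq> gens A B K" "finite F" "C = \<Inter>F"
    using C by (auto simp: meets_def Fpow_def)
  have "\<forall>x\<in>F. \<exists>k\<in>K. x = A k \<or> x = B k" using F(1) by (auto simp: gens_def)
  then obtain k where k: "\<And>x. x \<in> F \<Longrightarrow> k x \<in> K \<and> (x = A (k x) \<or> x = B (k x))" by metis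
  show ?thesis
  proof (cases "F = {}")
    case True
    then show ?thesis using F(3) large_UNIV by simp
  next
    case False
    then obtain m where m: "m \<in> k ` F" "k ` F \<subseteq> up_to m"
      using ex_last[of "k ` F"] F(2) by blast
    have "x \<in> gens A B (up_to m)" if "x \<in> F" for x
    proof -
      have "k x \<in> up_to m" using m(2) that by blast
      then show ?thesis using k[OF that] unfolding gens_def by blast
    qed
    then have "C \<in> meets (gens A B (up_to m))"
      using F(2,3) unfolding meets_def Fpow_def by blast
    moreover have "m \<in> K" using m(1) k by auto
    ultimately show ?thesis using assms(1) by simp
  qed
qed

text \<open>Three moves at stage \<open>i\<close>: earlier generators by induction, then
  \<open>A i\<close> by splitting, then \<open>B i\<close> by its task or because it is
  \<open>UNIV\<close>.\<close>

lemma large_up_to: "C \<in> meets (gens A B (up_to i)) \<Longrightarrow> large \<kappa> A UNIV C"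
proof (induction i arbitrary: C rule: wf_induct_rule[OF wf_continuum])
  case (1 i)
  let ?\<G> = "gens A B (before i)"
  have sub: "meets (insert (A i) ?\<G>) \<subseteq> meets (gens A B (up_to i))"
    unfolding gens_up_to by (rule meets_mono) blast
  have G: "large \<kappa> A UNIV C" if "C \<in> meets ?\<G>" for C
    using 1(1) that unfolding before_iff by (rule large_if_large_up_to)
  have GA: "large \<kappa> A UNIV X" if X: "X \<in> meets (insert (A i) ?\<G>)" for X
  proof -
    obtain C where C: "C \<in> meets ?\<G>" "C \<inter> A i \<subseteq> X" using meets_insert[OF X] by blast
    obtain T where T: "|T| <o \<kappa>" "\<And>\<sigma>. \<sigma> \<in> Fpow UNIV \<Longrightarrow> \<sigma> \<inter> T = {} \<Longrightarrow> infinite (C - \<Union>(A ` \<sigma>))"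
      using G[OF C(1)] unfolding large_def by blast
    \<comment> \<open>The index \<open>i\<close> becomes exceptional because \<open>A i\<close>
      itself covers \<open>C \<inter> A i\<close>.\<close>
    have "|insert i T| <o \<kappa>"
      using card_of_Un_ordLess_infinite_Field[of \<kappa> "{i}" T] T(1) Cinfinite
        finite_ordLess_Cinfinite[OF Cinfinite, of "{i}"]
      by (simp add: cinfinite_def)
    moreover have "infinite (X - \<Union>(A ` \<sigma>))" if s: "\<sigma> \<in> Fpow (up_to i)" "\<sigma> \<inter> insert i T = {}" for \<sigma>
    proof -
      have s': "\<sigma> \<in> Fpow (before i)" using s by (auto simp: Fpow_def)
      have "infinite (C - \<Union>(A ` \<sigma>))" using T(2)[of \<sigma>] s by (auto simp: Fpow_def)
      then have "infinite ((C - \<Union>(A ` \<sigma>)) \<inter> A i)"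
        using stage[of i] C(1) s' unfolding stage_def splits_def by blast
      moreover have "(C - \<Union>(A ` \<sigma>)) \<inter> A i \<subseteq> X - \<Union>(A ` \<sigma>)" using C(2) by blast
      ultimately show ?thesis using finite_subset by blast
    qed
    ultimately have "large \<kappa> A (up_to i) X" unfolding large_def by blast
    moreover have "X \<in> meets (gens A B (up_to i))" using X sub by blast
    ultimately show ?thesis using large_extend[OF up_to_downward_closed] by blast
  qed
  show ?case
  proof (cases "admissible \<kappa> A i (insert (A i) ?\<G>) (t i)")
    case True
    then have "large \<kappa> A (up_to i) C"
      using stage[of i] 1(2) unfolding stage_def meets_task_def gens_up_to by simp
    then show ?thesis using large_extend[OF up_to_downward_closed 1(2)] by blast
  next
    case False
    then have "B i = UNIV" using stage[of i] unfolding stage_def meets_task_def by simp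
    then show ?thesis using 1(2) GA unfolding gens_up_to by (simp add: meets_insert_UNIV)
  qed
qed

section \<open>The generated ultrafilter\<close>

text \<open>Closing under almost supersets puts every set that almost contains a member into the
  filter, in particular the cofinite sets.\<close>

definition \<U> :: "nat set set" where
  "\<U> = {X. \<exists>C\<in>meets (gens A B UNIV). finite (C - X)}"

lemma large_mem:
  assumes "X \<in> \<U>"
  shows "large \<kappa> A UNIV X"
proof -
  obtain C where C: "C \<in> meets (gens A B UNIV)" "finite (C - X)" using assms unfolding \<U>_def by blast
  have "large \<kappa> A UNIV C" using large_up_to C(1) by (rule large_if_large_up_to)
  then show ?thesis using C(2) by (rule large_almost_superset)
qed

lemma meets_subset: "meets (gens A B UNIV) \<subseteq> \<U>"
proof
  fix C assume "C \<in> meets (gens A B UNIV)"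
  moreover have "finite (C - C)" by simp
  ultimately show "C \<in> \<U>" unfolding \<U>_def by blast
qed

lemma gens_subset: "gens A B UNIV \<subseteq> \<U>"
  using meets_base meets_subset by blast

lemma Int_mem: "X \<in> \<U> \<Longrightarrow> Y \<in> \<U> \<Longrightarrow> X \<inter> Y \<in> \<U>"
proof -
  assume "X \<in> \<U>" "Y \<in> \<U>"
  then obtain C D where CD: "C \<in> meets (gens A B UNIV)" "D \<in> meets (gens A B UNIV)"
    "finite (C - X)" "finite (D - Y)" unfolding \<U>_def by blast
  have "C \<inter> D - X \<inter> Y \<subseteq> (C - X) \<union> (D - Y)" by blast
  then have "finite (C \<inter> D - X \<inter> Y)" using CD(3,4) by (meson finite_UnI finite_subset)
  then show ?thesis unfolding \<U>_def using meets_Int[OF CD(1,2)] by blast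
qed

lemma superset_mem: "X \<in> \<U> \<Longrightarrow> X \<subseteq> Y \<Longrightarrow> Y \<in> \<U>"
proof -
  assume X: "X \<in> \<U>" and XY: "X \<subseteq> Y"
  then obtain C where "C \<in> meets (gens A B UNIV)" "finite (C - X)" unfolding \<U>_def by blast
  moreover have "finite (C - Y)"
    using \<open>finite (C - X)\<close> by (rule finite_subset[rotated]) (use XY in blast)
  ultimately show ?thesis unfolding \<U>_def by blast
qed

lemma UNIV_mem: "UNIV \<in> \<U>"
  using UNIV_in_meets meets_subset by blast

lemma Inter_mem: "finite F \<Longrightarrow> F \<subseteq> \<U> \<Longrightarrow> \<Inter>F \<in> \<U>"
  by (induction F rule: finite_induct) (auto simp: UNIV_mem Int_mem)

text \<open>The turn of \<open>s\<close> decides. If refused, some \<open>C \<inter> D\<close> is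
  not large up to \<open>i\<close>, hence not large against all indices, and \<open>C\<close> is in
  the filter: a refusal is permanent.\<close>

lemma pseudointersection_or_not_large:
  assumes "|s| <o \<kappa>"
  shows "(\<exists>b\<in>\<U>. \<forall>x\<in>s. finite (b - x)) \<or>
    (\<exists>C\<in>\<U>. \<exists>D\<in>meets s. \<not> large \<kappa> A UNIV (C \<inter> D))"
proof -
  obtain i where i: "t i = s"
    using enumerates[OF ordLess_ordLeq_trans[OF assms ordLeq_continuum]] by blast
  let ?\<G> = "insert (A i) (gens A B (before i))"
  show ?thesis
  proof (cases "admissible \<kappa> A i ?\<G> s")
    case True
    then have "\<forall>x\<in>s. finite (B i - x)"
      using stage[of i] i unfolding stage_def meets_task_def by simp
    moreover have "B i \<in> \<U>" using gens_subset by (auto simp: gens_def)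
    ultimately show ?thesis by blast
  next
    case False
    then obtain X where X: "X \<in> meets (?\<G> \<union> s)" "\<not> large \<kappa> A (up_to i) X"
      using assms unfolding admissible_def by blast
    obtain C D where CD: "C \<in> meets ?\<G>" "D \<in> meets s" "X = C \<inter> D"
      using X(1) unfolding meets_Un by blast
    have "?\<G> \<subseteq> gens A B UNIV" by (auto simp: gens_def)
    then have "C \<in> \<U>" using CD(1) meets_mono meets_subset by blast
    moreover have "\<not> large \<kappa> A UNIV (C \<inter> D)"
      using X(2) CD(3) large_antimono[OF _ subset_UNIV] by blast
    ultimately show ?thesis using CD(2) by blast
  qed
qed

text \<open>For \<open>s\<close> inside the filter a refusal is impossible, as each
  \<open>C \<inter> D\<close> is again a member and so large.\<close>

lemma ex_pseudointersection_mem: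
  assumes "|s| <o \<kappa>" "s \<subseteq> \<U>"
  shows "\<exists>b\<in>\<U>. \<forall>x\<in>s. finite (b - x)"
proof -
  have "large \<kappa> A UNIV (C \<inter> D)" if "C \<in> \<U>" "D \<in> meets s" for C D
  proof (rule large_mem, rule Int_mem[OF that(1)])
    show "D \<in> \<U>" using that(2) assms(2) Inter_mem by (auto simp: meets_def Fpow_def)
  qed
  then have "\<not> (\<exists>C\<in>\<U>. \<exists>D\<in>meets s. \<not> large \<kappa> A UNIV (C \<inter> D))" by simp
  then show ?thesis using pseudointersection_or_not_large[OF assms(1)] by simp
qed

text \<open>Maximality of the filter, from the task \<open>{X}\<close>.\<close>

lemma mem_or_not_large: "X \<in> \<U> \<or> (\<exists>C\<in>\<U>. \<not> large \<kappa> A UNIV (C \<inter> X))"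
proof -
  consider b where "b \<in> \<U>" "finite (b - X)" |
    C D where "C \<in> \<U>" "D \<in> meets {X}" "\<not> large \<kappa> A UNIV (C \<inter> D)"
    using pseudointersection_or_not_large[of "{X}"] finite_ordLess_Cinfinite[OF Cinfinite, of "{X}"]
    by auto
  then show ?thesis
  proof cases
    case 1
    then obtain C where C: "C \<in> meets (gens A B UNIV)" "finite (C - b)" unfolding \<U>_def by blast
    have "C - X \<subseteq> (C - b) \<union> (b - X)" by blast
    then have "finite (C - X)" using C(2) 1(2) by (meson finite_UnI finite_subset)
    then show ?thesis using C(1) unfolding \<U>_def by blast
  next
    case 2
    have "C \<inter> X \<subseteq> C \<inter> D" using meets_singleton[OF 2(2)] by blast
    then show ?thesis using 2 large_superset by blast
  qed
qed

lemma ultrafilter: "ultrafilter_nat \<U>"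
  unfolding ultrafilter_nat_def
proof (intro conjI ballI allI impI)
  show "{} \<notin> \<U>" using large_mem large_infinite by blast
  fix X
  show "X \<in> \<U> \<or> - X \<in> \<U>"
  proof (rule ccontr)
    assume "\<not> ?thesis"
    then obtain C D where CD: "C \<in> \<U>" "\<not> large \<kappa> A UNIV (C \<inter> X)"
      "D \<in> \<U>" "\<not> large \<kappa> A UNIV (D \<inter> - X)"
      using mem_or_not_large[of X] mem_or_not_large[of "- X"] by blast
    \<comment> \<open>\<open>C \<inter> D\<close> is in the filter, so one of its two pieces is
      large, against the choice of \<open>C\<close> or of \<open>D\<close>.\<close>
    have "large \<kappa> A UNIV (C \<inter> D \<inter> X) \<or> large \<kappa> A UNIV (C \<inter> D - X)"
      by (intro large_Int_or_Diff large_mem Int_mem CD)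
    then show False
      using CD(2,4) large_superset[of \<kappa> A UNIV "C \<inter> D \<inter> X" "C \<inter> X"]
        large_superset[of \<kappa> A UNIV "C \<inter> D - X" "D \<inter> - X"] by blast
  qed
qed (use UNIV_mem Int_mem superset_mem in auto)

lemma nonprincipal: "nonprincipal \<U>"
  unfolding nonprincipal_def
proof
  assume "\<exists>n. \<U> = {X. n \<in> X}"
  then obtain n where "{n} \<in> \<U>" by blast
  then show False using large_mem large_infinite by blast
qed

section \<open>The two Tukey maps\<close>

text \<open>Members of the filter are themselves elements of the field of \<open>\<cc>\<close>. A
  bound of the singletons contains the whole family, which is then smaller than
  \<open>\<kappa>\<close> and has a pseudointersection in the filter.\<close>

lemma tukey_le_subsets_below: "tukey_le \<U> (\<supseteq>*) (subsets_below \<cc> \<kappa>) (\<subseteq>)"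
  unfolding tukey_le_def tukey_map_def
proof (intro exI[of _ "\<lambda>X. {X}"] conjI allI impI)
  show "(\<lambda>X. {X}) ` \<U> \<subseteq> subsets_below \<cc> \<kappa>"
  proof (rule image_subsetI)
    fix X :: "nat set"
    have "|{X}| <o \<kappa>" by (rule finite_ordLess_Cinfinite[OF Cinfinite]) simp
    then show "{X} \<in> subsets_below \<cc> \<kappa>" by (simp add: subsets_below_def)
  qed
  fix X assume X: "X \<subseteq> \<U>" "\<not> bounded_in \<U> (\<supseteq>*) X"
  show "\<not> bounded_in (subsets_below \<cc> \<kappa>) (\<subseteq>) ((\<lambda>X. {X}) ` X)"
  proof
    assume "bounded_in (subsets_below \<cc> \<kappa>) (\<subseteq>) ((\<lambda>X. {X}) ` X)"
    then obtain u where "u \<in> subsets_below \<cc> \<kappa>" "\<forall>x\<in>X. {x} \<subseteq> u" unfolding bounded_in_def by auto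
    then have "|u| <o \<kappa>" "X \<subseteq> u" by (auto simp: subsets_below_def)
    then have "|X| <o \<kappa>" using card_of_mono1 ordLeq_ordLess_trans by blast
    then obtain b where "b \<in> \<U>" "\<forall>x\<in>X. finite (b - x)"
      using ex_pseudointersection_mem X(1) by blast
    then show False using X(2) unfolding bounded_in_def almost_superset_def by blast
  qed
qed

lemma subsets_below_tukey_le: "tukey_le (subsets_below \<cc> \<kappa>) (\<subseteq>) \<U> (\<supseteq>*)"
proof -
  have "\<exists>b\<in>\<U>. \<forall>i\<in>S. finite (b - A i)" if "S \<in> subsets_below \<cc> \<kappa>" for S
  proof -
    have "|A ` S| <o \<kappa>" using that by (intro card_of_image_ordLess) (simp add: subsets_below_def)
    moreover have "A ` S \<subseteq> \<U>" using gens_subset by (auto simp: gens_def)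
    ultimately have "\<exists>b\<in>\<U>. \<forall>x\<in>A ` S. finite (b - x)" by (rule ex_pseudointersection_mem)
    then show ?thesis by simp
  qed
  then have "\<forall>S\<in>subsets_below \<cc> \<kappa>. \<exists>b. b \<in> \<U> \<and> (\<forall>i\<in>S. finite (b - A i))" by blast
  from bchoice[OF this] obtain f where f: "\<And>S. S \<in> subsets_below \<cc> \<kappa> \<Longrightarrow> f S \<in> \<U>"
    "\<And>S i. S \<in> subsets_below \<cc> \<kappa> \<Longrightarrow> i \<in> S \<Longrightarrow> finite (f S - A i)"
    by blast
  have "tukey_map (subsets_below \<cc> \<kappa>) (\<subseteq>) \<U> (\<supseteq>*) f"
    unfolding tukey_map_def
  proof (intro conjI allI impI notI)
    show "f ` subsets_below \<cc> \<kappa> \<subseteq> \<U>" using f(1) by blast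
    fix X assume X: "X \<subseteq> subsets_below \<cc> \<kappa>" "\<not> bounded_in (subsets_below \<cc> \<kappa>) (\<subseteq>) X"
    assume "bounded_in \<U> (\<supseteq>*) (f ` X)"
    then obtain b where b: "b \<in> \<U>" "\<And>S. S \<in> X \<Longrightarrow> finite (b - f S)"
      unfolding bounded_in_def almost_superset_def by auto
    have "finite (b - A i)" if "S \<in> X" "i \<in> S" for S i
    proof (rule finite_subset)
      show "b - A i \<subseteq> (b - f S) \<union> (f S - A i)" by blast
      show "finite ((b - f S) \<union> (f S - A i))" using b(2) f(2) X(1) that by blast
    qed
    \<comment> \<open>The indices \<open>i\<close> with \<open>b\<close> almost inside
      \<open>A i\<close> form a set smaller than \<open>\<kappa>\<close>, as \<open>b\<close> is
      large; this set bounds \<open>X\<close>.\<close>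
    then have "\<Union>X \<subseteq> {i. finite (b - A i)}" by blast
    moreover have "{i. finite (b - A i)} \<in> subsets_below \<cc> \<kappa>"
      using card_of_large[OF large_mem[OF b(1)]] by (simp add: subsets_below_def)
    ultimately show False using X(2) unfolding bounded_in_def by blast
  qed
  then show ?thesis unfolding tukey_le_def by blast
qed

end

theorem theorem3p18:
  fixes \<kappa> :: "'k rel"
  assumes "\<pp> =o \<cc>"
    and "Card_order \<kappa>" and "cinfinite \<kappa>" and "regularCard \<kappa>" and "\<kappa> \<le>o \<cc>"
  shows "\<exists>U. ultrafilter_nat U \<and> nonprincipal U \<and>
           tukey_equiv U (\<supseteq>*) (subsets_below \<cc> \<kappa>) (\<subseteq>)"
proof -
  interpret pseudointersections_below_continuum
    using assms(1) by (rule pseudointersections_below_continuumI)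
  interpret tukey_construction \<kappa> by unfold_locales (use assms in auto)
  obtain t :: "nat set \<Rightarrow> nat set set" where t: "\<And>s. |s| <o \<cc> \<Longrightarrow> s \<in> range t"
    using ex_enumeration_small_families by blast
  obtain A B where "\<And>i. stage \<kappa> t A B i" using ex_stages by blast
  then interpret tukey_stages \<kappa> t A B by unfold_locales (use t in auto)
  show ?thesis
    unfolding tukey_equiv_def
    using ultrafilter nonprincipal tukey_le_subsets_below subsets_below_tukey_le by blast
qed

end
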